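(* Let $K$ be a commutative ring with unit which is an integral domain, let $W$ be a finite group with $|W|\in U(K)$, let $\chi\colon W\to U(K)$ be a group homomorphism, and let $M$ be a free $K$-module with basis $(e_i)_{i\in I}$ endowed with the monomial $W$-module structure $\sigma e_i=\gamma_i(\sigma)e_{\sigma i}$ described in the context. Then: (i) the union of the families $$e_i-\chi^{-1}(\sigma)\gamma_i(\sigma)e_{\sigma i}\quad (i\in I^*,\ \sigma\in W^{(i)},\ \sigma\notin W_i)\qquad\text{and}\qquad e_i\quad (i\in J_0(\chi,M))$$ is a basis of the $K$-module ${}_\chi M$; (ii) the family $a_\chi(e_j)$, $j\in J(\chi,M)$, is a basis of the $K$-module $M_\chi$; (iii) the family $e_j \bmod {}_\chi M$, $j\in J(\chi,M)$, is a basis of the factor-module $M/{}_\chi M$.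
   Context: $U(K)$ is the group of units of $K$. The finite group $W$ acts (on the left) on the index set $I$; $W_i$ is the stabilizer of $i\in I$, and $W^{(i)}$ is a system of representatives of the left classes of $W$ modulo $W_i$. $(\gamma_i)_{i\in I}$ is a family of maps $\gamma_i\colon W\to U(K)$ with $\gamma_i(\sigma\tau)=\gamma_{\tau i}(\sigma)\gamma_i(\tau)$ for all $i\in I$, $\sigma,\tau\in W$ (so $\gamma_i|_{W_i}$ is a character of $W_i$), and $W$ acts $K$-linearly on $M$ by $\sigma e_i=\gamma_i(\sigma)e_{\sigma i}$. ${}_\chi M$ is the submodule of $M$ generated by all differences $\chi(\sigma)z-\sigma z$, $\sigma\in W$, $z\in M$; $M_\chi=\{z\in M\mid \sigma z=\chi(\sigma)z\text{ for all }\sigma\in W\}$. $a_\chi=|W|^{-1}\sum_{\sigma\in W}\chi^{-1}(\sigma)\sigma\in KW$, where $\chi^{-1}(\sigma)=\chi(\sigma)^{-1}$, and $a_\chi$ also denotes the endomorphism $z\mapsto a_\chi z$ of $M$. $I(\chi,M)=\{i\in I\mid \gamma_i=\chi\text{ on }W_i\}$, $I_0(\chi,M)=I\setminus I(\chi,M)$. $I^*\subset I$ is a set containing exactly one element of each $W$-orbit in $I$; $J(\chi,M)=I^*\cap I(\chi,M)$ and $J_0(\chi,M)=I^*\cap I_0(\chi,M)$. *)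

theory Defs
  imports "HOL-Algebra.Module" "HOL-Algebra.QuotRing" "HOL-Algebra.Group_Action"
    "HOL-Algebra.Left_Coset"
begin

section \<open>Generated submodules, bases, factor modules\<close>

definition submodule_gen :: "('k, _) ring_scheme \<Rightarrow> ('k, 'm, _) module_scheme \<Rightarrow> 'm set \<Rightarrow> 'm set"
  where "submodule_gen K M S = \<Inter>{N. submodule N K M \<and> S \<subseteq> N}"

definition lin_indep_family :: "('k, _) ring_scheme \<Rightarrow> ('k, 'm, _) module_scheme
    \<Rightarrow> 'j set \<Rightarrow> ('j \<Rightarrow> 'm) \<Rightarrow> bool"
  where "lin_indep_family K M J f \<longleftrightarrow>
    (\<forall>F c. finite F \<and> F \<subseteq> J \<and> c \<in> F \<rightarrow> carrier K \<and>
           (\<Oplus>\<^bsub>M\<^esub>j\<in>F. c j \<odot>\<^bsub>M\<^esub> f j) = \<zero>\<^bsub>M\<^esub> \<longrightarrow> (\<forall>j\<in>F. c j = \<zero>\<^bsub>K\<^esub>))"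

definition basis_family :: "('k, _) ring_scheme \<Rightarrow> ('k, 'm, _) module_scheme
    \<Rightarrow> 'j set \<Rightarrow> ('j \<Rightarrow> 'm) \<Rightarrow> bool"
  where "basis_family K M J f \<longleftrightarrow>
    f \<in> J \<rightarrow> carrier M \<and> lin_indep_family K M J f \<and> submodule_gen K M (f ` J) = carrier M"

text \<open>
  The fields \<open>mult\<close> and \<open>one\<close> of a module record play no role for modules; they are filled
  as in \<^const>\<open>FactRing\<close>.  In the scalar product the union is over representatives of a coset,
  all of which yield the same coset when \<open>N\<close> is a submodule (see the second part of
  \<open>factor_module_module\<close>).
\<close>

definition factor_module :: "('k, 'm, _) module_scheme \<Rightarrow> 'm set \<Rightarrow> ('k, 'm set) module"
  where "factor_module M N =
    \<lparr>carrier = a_rcosets\<^bsub>M\<^esub> N, mult = rcoset_mult M N, one = N +>\<^bsub>M\<^esub> \<one>\<^bsub>M\<^esub>,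
     zero = N, add = set_add M, smult = (\<lambda>a X. \<Union>x\<in>X. N +>\<^bsub>M\<^esub> (a \<odot>\<^bsub>M\<^esub> x))\<rparr>"

lemma (in module) submodule_gen_submodule:
  assumes "S \<subseteq> carrier M" shows "submodule (submodule_gen R M S) R M"
proof (rule submoduleI)
  show "submodule_gen R M S \<subseteq> carrier M"
    unfolding submodule_gen_def using carrier_is_submodule assms by auto
qed (auto simp: submodule_gen_def dest: submoduleE submodule.smult_closed
  intro: subgroup.one_closed[of _ "add_monoid M", simplified] submodule.axioms)

lemma (in module) factor_module_module:
  assumes N: "submodule N R M"
  shows "module R (factor_module M N)"
    and "x \<in> carrier M \<Longrightarrow> a \<in> carrier R \<Longrightarrow>
      a \<odot>\<^bsub>factor_module M N\<^esub> (N +>\<^bsub>M\<^esub> x) = N +>\<^bsub>M\<^esub> (a \<odot>\<^bsub>M\<^esub> x)"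
proof -
  interpret N: submodule N R M by fact
  interpret AS: abelian_subgroup N M
    by (rule abelian_subgroupI3) (auto intro: additive_subgroup.intro N.subgroup_axioms abelian_group_axioms)
  have sm: "a \<odot>\<^bsub>factor_module M N\<^esub> (N +>\<^bsub>M\<^esub> x) = N +>\<^bsub>M\<^esub> (a \<odot>\<^bsub>M\<^esub> x)"
    if x: "x \<in> carrier M" and a: "a \<in> carrier R" for a x
  proof -
    have "N +>\<^bsub>M\<^esub> (a \<odot>\<^bsub>M\<^esub> y) = N +>\<^bsub>M\<^esub> (a \<odot>\<^bsub>M\<^esub> x)" if y: "y \<in> N +>\<^bsub>M\<^esub> x" for y
    proof -
      obtain n where n: "n \<in> N" "y = n \<oplus>\<^bsub>M\<^esub> x" using y by (auto simp: a_r_coset_def')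
      have nM: "n \<in> carrier M" using n AS.a_subset by auto
      have "a \<odot>\<^bsub>M\<^esub> y = a \<odot>\<^bsub>M\<^esub> n \<oplus>\<^bsub>M\<^esub> a \<odot>\<^bsub>M\<^esub> x" using n nM x a by (simp add: smult_r_distr)
      moreover have "a \<odot>\<^bsub>M\<^esub> n \<in> N" using n(1) a by (rule N.smult_closed[rotated])
      ultimately have "a \<odot>\<^bsub>M\<^esub> y \<in> N +>\<^bsub>M\<^esub> (a \<odot>\<^bsub>M\<^esub> x)" unfolding a_r_coset_def' by blast
      from M.a_repr_independence[OF this smult_closed[OF a x] N.subgroup_axioms] show ?thesis by (rule sym)
    qed
    moreover have "x \<in> N +>\<^bsub>M\<^esub> x" using x AS.a_rcos_self by blast
    ultimately have "(\<Union>y\<in>N +>\<^bsub>M\<^esub> x. N +>\<^bsub>M\<^esub> (a \<odot>\<^bsub>M\<^esub> y)) = N +>\<^bsub>M\<^esub> (a \<odot>\<^bsub>M\<^esub> x)" by blast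
    then show ?thesis unfolding factor_module_def by simp
  qed
  then show "x \<in> carrier M \<Longrightarrow> a \<in> carrier R \<Longrightarrow>
      a \<odot>\<^bsub>factor_module M N\<^esub> (N +>\<^bsub>M\<^esub> x) = N +>\<^bsub>M\<^esub> (a \<odot>\<^bsub>M\<^esub> x)" .
  have rep: "\<exists>x\<in>carrier M. X = N +>\<^bsub>M\<^esub> x" if "X \<in> carrier (factor_module M N)" for X
    using that by (auto simp: factor_module_def A_RCOSETS_def')
  have cl: "N +>\<^bsub>M\<^esub> x \<in> carrier (factor_module M N)" if "x \<in> carrier M" for x
    using that by (auto simp: factor_module_def A_RCOSETS_def')
  have ad: "(N +>\<^bsub>M\<^esub> x) \<oplus>\<^bsub>factor_module M N\<^esub> (N +>\<^bsub>M\<^esub> y) = N +>\<^bsub>M\<^esub> (x \<oplus>\<^bsub>M\<^esub> y)"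
    if "x \<in> carrier M" "y \<in> carrier M" for x y
    using that AS.a_rcos_sum by (simp add: factor_module_def)
  have ag: "abelian_group (factor_module M N)"
  proof (rule abelian_groupI)
    show "\<zero>\<^bsub>factor_module M N\<^esub> \<in> carrier (factor_module M N)"
      using cl[of "\<zero>\<^bsub>M\<^esub>"] M.a_coset_add_zero[OF AS.a_subset] by (simp add: factor_module_def)
    have z: "\<zero>\<^bsub>factor_module M N\<^esub> = N +>\<^bsub>M\<^esub> \<zero>\<^bsub>M\<^esub>" 
      using M.a_coset_add_zero[OF AS.a_subset] by (simp add: factor_module_def)
    fix X assume "X \<in> carrier (factor_module M N)"
    then obtain x where x: "x \<in> carrier M" "X = N +>\<^bsub>M\<^esub> x" using rep by blast
    show "\<zero>\<^bsub>factor_module M N\<^esub> \<oplus>\<^bsub>factor_module M N\<^esub> X = X" using x z by (simp add: ad)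
    show "\<exists>y\<in>carrier (factor_module M N). y \<oplus>\<^bsub>factor_module M N\<^esub> X = \<zero>\<^bsub>factor_module M N\<^esub>"
      using x z by (intro bexI[of _ "N +>\<^bsub>M\<^esub> (\<ominus>\<^bsub>M\<^esub> x)"]) (auto simp: ad cl M.l_neg)
  next
    fix X Y assume "X \<in> carrier (factor_module M N)" "Y \<in> carrier (factor_module M N)"
    then obtain x y where x: "x \<in> carrier M" "X = N +>\<^bsub>M\<^esub> x" "y \<in> carrier M" "Y = N +>\<^bsub>M\<^esub> y" using rep by blast
    show "X \<oplus>\<^bsub>factor_module M N\<^esub> Y \<in> carrier (factor_module M N)" using x by (simp add: ad cl)
    show "X \<oplus>\<^bsub>factor_module M N\<^esub> Y = Y \<oplus>\<^bsub>factor_module M N\<^esub> X" using x by (simp add: ad M.a_comm)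
    fix Z assume "Z \<in> carrier (factor_module M N)"
    then obtain z where z: "z \<in> carrier M" "Z = N +>\<^bsub>M\<^esub> z" using rep by blast
    show "X \<oplus>\<^bsub>factor_module M N\<^esub> Y \<oplus>\<^bsub>factor_module M N\<^esub> Z = X \<oplus>\<^bsub>factor_module M N\<^esub> (Y \<oplus>\<^bsub>factor_module M N\<^esub> Z)"
      using x z by (simp add: ad M.a_assoc)
  qed
  show "module R (factor_module M N)"
  proof (rule moduleI)
    show "cring R" by (rule R.cring_axioms)
    show "abelian_group (factor_module M N)" by (rule ag)
  next
    fix a X assume a: "a \<in> carrier R" and "X \<in> carrier (factor_module M N)"
    then obtain x where x: "x \<in> carrier M" "X = N +>\<^bsub>M\<^esub> x" using rep by blast
    show "a \<odot>\<^bsub>factor_module M N\<^esub> X \<in> carrier (factor_module M N)"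
      unfolding x sm[OF x(1) a] by (rule cl) (simp add: a x)
    fix b assume b: "b \<in> carrier R"
    show "(a \<oplus>\<^bsub>R\<^esub> b) \<odot>\<^bsub>factor_module M N\<^esub> X = a \<odot>\<^bsub>factor_module M N\<^esub> X \<oplus>\<^bsub>factor_module M N\<^esub> b \<odot>\<^bsub>factor_module M N\<^esub> X"
      using a b x by (simp add: sm ad smult_l_distr)
    show "(a \<otimes>\<^bsub>R\<^esub> b) \<odot>\<^bsub>factor_module M N\<^esub> X = a \<odot>\<^bsub>factor_module M N\<^esub> (b \<odot>\<^bsub>factor_module M N\<^esub> X)"
      using a b x by (simp add: sm smult_assoc1)
  next
    fix a X Y assume a: "a \<in> carrier R" and "X \<in> carrier (factor_module M N)" "Y \<in> carrier (factor_module M N)"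
    then obtain x y where x: "x \<in> carrier M" "X = N +>\<^bsub>M\<^esub> x" "y \<in> carrier M" "Y = N +>\<^bsub>M\<^esub> y" using rep by blast
    show "a \<odot>\<^bsub>factor_module M N\<^esub> (X \<oplus>\<^bsub>factor_module M N\<^esub> Y) = a \<odot>\<^bsub>factor_module M N\<^esub> X \<oplus>\<^bsub>factor_module M N\<^esub> a \<odot>\<^bsub>factor_module M N\<^esub> Y"
      using a x by (simp add: sm ad smult_r_distr)
  next
    fix X assume "X \<in> carrier (factor_module M N)"
    then obtain x where x: "x \<in> carrier M" "X = N +>\<^bsub>M\<^esub> x" using rep by blast
    show "\<one>\<^bsub>R\<^esub> \<odot>\<^bsub>factor_module M N\<^esub> X = X" using x by (simp add: sm)
  qed
qed


section \<open>Linear actions of a group on a module\<close>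

locale linear_action = module K M + group_action W "carrier M" act
  for K :: "'k ring" and W :: "'w monoid" and M :: "('k, 'm) module"
    and act :: "'w \<Rightarrow> 'm \<Rightarrow> 'm" +
  assumes act_add: "\<lbrakk>\<sigma> \<in> carrier W; x \<in> carrier M; y \<in> carrier M\<rbrakk>
      \<Longrightarrow> act \<sigma> (x \<oplus>\<^bsub>M\<^esub> y) = act \<sigma> x \<oplus>\<^bsub>M\<^esub> act \<sigma> y"
    and act_smult: "\<lbrakk>\<sigma> \<in> carrier W; a \<in> carrier K; x \<in> carrier M\<rbrakk>
      \<Longrightarrow> act \<sigma> (a \<odot>\<^bsub>M\<^esub> x) = a \<odot>\<^bsub>M\<^esub> act \<sigma> x"

text \<open>\<open>chi_diffs\<close> is \<open>\<^sub>\<chi>M\<close> and \<open>chi_invs\<close> is \<open>M\<^sub>\<chi>\<close>.\<close>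

definition chi_diffs ::
  "'k ring \<Rightarrow> 'w monoid \<Rightarrow> ('k, 'm) module \<Rightarrow> ('w \<Rightarrow> 'm \<Rightarrow> 'm) \<Rightarrow> ('w \<Rightarrow> 'k) \<Rightarrow> 'm set"
  where "chi_diffs K W M act \<chi> =
    submodule_gen K M {\<chi> \<sigma> \<odot>\<^bsub>M\<^esub> z \<ominus>\<^bsub>M\<^esub> act \<sigma> z | \<sigma> z. \<sigma> \<in> carrier W \<and> z \<in> carrier M}"

definition chi_invs ::
  "'w monoid \<Rightarrow> ('k, 'm) module \<Rightarrow> ('w \<Rightarrow> 'm \<Rightarrow> 'm) \<Rightarrow> ('w \<Rightarrow> 'k) \<Rightarrow> 'm set"
  where "chi_invs W M act \<chi> =
    {z \<in> carrier M. \<forall>\<sigma>\<in>carrier W. act \<sigma> z = \<chi> \<sigma> \<odot>\<^bsub>M\<^esub> z}"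

lemma (in linear_action) chi_diffs_submodule:
  assumes "\<chi> \<in> hom W (units_of K)"
  shows "submodule (chi_diffs K W M act \<chi>) K M"
  unfolding chi_diffs_def
proof (rule submodule_gen_submodule, clarsimp)
  fix \<sigma> z assume a: "\<sigma> \<in> carrier W" "z \<in> carrier M"
  have "\<chi> \<sigma> \<in> carrier K" using assms a by (auto simp: hom_def units_of_def Units_def)
  then show "\<chi> \<sigma> \<odot>\<^bsub>M\<^esub> z \<ominus>\<^bsub>M\<^esub> act \<sigma> z \<in> carrier M"
    using a element_image by blast
qed

lemma (in linear_action) chi_invs_submodule:
  assumes "\<chi> \<in> hom W (units_of K)"
  shows "submodule (chi_invs W M act \<chi>) K M"
proof -
  have c: "\<chi> \<sigma> \<in> carrier K" if "\<sigma> \<in> carrier W" for \<sigma>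
    using assms that by (auto simp: hom_def units_of_def Units_def)
  have z: "act \<sigma> \<zero>\<^bsub>M\<^esub> = \<zero>\<^bsub>M\<^esub>" if "\<sigma> \<in> carrier W" for \<sigma>
    using act_smult[OF that, of "\<zero>\<^bsub>K\<^esub>" "\<zero>\<^bsub>M\<^esub>"] element_image[OF that, of "\<zero>\<^bsub>M\<^esub>"] by simp
  have m: "\<ominus>\<^bsub>M\<^esub> x = (\<ominus>\<^bsub>K\<^esub> \<one>\<^bsub>K\<^esub>) \<odot>\<^bsub>M\<^esub> x" if "x \<in> carrier M" for x
    using smult_l_minus[of "\<one>\<^bsub>K\<^esub>" x] that by simp
  show ?thesis
    apply (rule submoduleI)
        apply (auto simp: chi_invs_def z c act_add smult_r_distr m act_smult)
     apply (metis R.one_closed R.a_inv_closed R.m_comm c smult_assoc1)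
    by (metis R.m_comm c smult_assoc1)
qed

text \<open>
  An element of the group algebra \<open>KW\<close> of a finite group is given by its coefficient
  function \<open>W \<rightarrow> K\<close>; \<open>ga_act\<close> is the induced action of \<open>KW\<close> on \<open>M\<close>.
\<close>

definition ga_act ::
  "'w monoid \<Rightarrow> ('k, 'm) module \<Rightarrow> ('w \<Rightarrow> 'm \<Rightarrow> 'm) \<Rightarrow> ('w \<Rightarrow> 'k) \<Rightarrow> 'm \<Rightarrow> 'm"
  where "ga_act W M act a z = (\<Oplus>\<^bsub>M\<^esub>\<sigma>\<in>carrier W. a \<sigma> \<odot>\<^bsub>M\<^esub> act \<sigma> z)"

definition a_chi :: "'k ring \<Rightarrow> 'w monoid \<Rightarrow> ('w \<Rightarrow> 'k) \<Rightarrow> 'w \<Rightarrow> 'k"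
  where "a_chi K W \<chi> =
    (\<lambda>\<sigma>\<in>carrier W. inv\<^bsub>K\<^esub> ([order W] \<cdot>\<^bsub>K\<^esub> \<one>\<^bsub>K\<^esub>) \<otimes>\<^bsub>K\<^esub> inv\<^bsub>K\<^esub> (\<chi> \<sigma>))"


section \<open>Index sets\<close>

text \<open>\<open>\<phi>\<close> is the action of \<open>W\<close> on the index set \<open>I\<close>.\<close>

definition index_chi ::
  "'w monoid \<Rightarrow> 'i set \<Rightarrow> ('w \<Rightarrow> 'i \<Rightarrow> 'i) \<Rightarrow> ('i \<Rightarrow> 'w \<Rightarrow> 'k) \<Rightarrow> ('w \<Rightarrow> 'k) \<Rightarrow> 'i set"
  where "index_chi W I \<phi> \<gamma> \<chi> = {i \<in> I. \<forall>\<sigma>\<in>stabilizer W \<phi> i. \<gamma> i \<sigma> = \<chi> \<sigma>}"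

definition orbit_transversal :: "'w monoid \<Rightarrow> 'i set \<Rightarrow> ('w \<Rightarrow> 'i \<Rightarrow> 'i) \<Rightarrow> 'i set \<Rightarrow> bool"
  where "orbit_transversal W I \<phi> T \<longleftrightarrow>
    T \<subseteq> I \<and> (\<forall>B\<in>orbits W I \<phi>. \<exists>!i. i \<in> T \<and> i \<in> B)"

definition left_transversal :: "'w monoid \<Rightarrow> 'w set \<Rightarrow> 'w set \<Rightarrow> bool"
  where "left_transversal W H R \<longleftrightarrow>
    R \<subseteq> carrier W \<and> (\<forall>C\<in>lcosets\<^bsub>W\<^esub> H. \<exists>!\<sigma>. \<sigma> \<in> R \<and> \<sigma> \<in> C)"

end

theory Submission
  imports Defs
begin

text \<open>
  Replacing the action by \<open>z \<mapsto> \<chi>\<^sup>-\<^sup>1(\<sigma>) \<sigma> z\<close> reduces everything to the trivial character.  The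
  average \<open>avg\<close> over \<open>W\<close> then has kernel \<open>diffs\<close>, the submodule generated by the
  \<open>z - \<sigma> z\<close>, and it kills \<open>e\<^sub>i\<close> when the character of the stabilizer of \<open>i\<close> is
  nontrivial, because \<open>(\<gamma>\<^sub>i(\<sigma>) - 1) avg e\<^sub>i = 0\<close> and a free module over a domain is
  torsion-free.  The vectors \<open>e\<^sub>i - \<sigma> e\<^sub>i\<close> together with the \<open>e\<^sub>i\<close> for \<open>i\<close> in the
  orbit transversal are linearly independent, since each \<open>\<sigma> i\<close> outside the transversal
  occurs in exactly one of them.  All of them except the \<open>e\<^sub>j\<close> with trivial stabilizer
  character generate \<open>diffs\<close>, so these \<open>e\<^sub>j\<close> form a basis modulo \<open>diffs\<close>, and \<open>avg\<close>
  carries it to a basis of the fixed points.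
\<close>

section \<open>Generated submodules and linear independence\<close>

context module
begin

section \<open>Elementary facts on submodules\<close>

lemma submodule_carrier: "submodule N R M \<Longrightarrow> x \<in> N \<Longrightarrow> x \<in> carrier M"
  by (meson submoduleE(1) subsetD)

lemma submodule_zero: "submodule N R M \<Longrightarrow> \<zero>\<^bsub>M\<^esub> \<in> N"
  using subgroup.one_closed[of N "add_monoid M"] submodule.axioms(1) by auto

lemma submodule_minus: "submodule N R M \<Longrightarrow> x \<in> N \<Longrightarrow> y \<in> N \<Longrightarrow> x \<ominus>\<^bsub>M\<^esub> y \<in> N"
  unfolding a_minus_def by (intro submoduleE(5) submoduleE(3))

lemma submodule_finsum:
  assumes "submodule N R M" "\<And>j. j \<in> F \<Longrightarrow> f j \<in> N"
  shows "finsum M f F \<in> N"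
  using assms(2)
proof (induction F rule: infinite_finite_induct)
  case (insert x F)
  moreover have "f \<in> F \<rightarrow> carrier M" "f x \<in> carrier M"
    using insert.prems submodule_carrier[OF assms(1)] by auto
  ultimately show ?case by (simp add: submoduleE(5)[OF assms(1)])
qed (simp_all add: submodule_zero[OF assms(1)])

lemma submodule_minus_left_iff:
  assumes "submodule N R M" "x \<in> N" "y \<in> carrier M"
  shows "x \<ominus>\<^bsub>M\<^esub> y \<in> N \<longleftrightarrow> y \<in> N"
proof
  assume "x \<ominus>\<^bsub>M\<^esub> y \<in> N"
  then have "x \<ominus>\<^bsub>M\<^esub> (x \<ominus>\<^bsub>M\<^esub> y) \<in> N" using assms submodule_minus by blast
  moreover have "x \<ominus>\<^bsub>M\<^esub> (x \<ominus>\<^bsub>M\<^esub> y) = y"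
    using assms submodule_carrier[OF assms(1,2)]
    by (simp add: a_minus_def M.minus_add M.a_assoc[symmetric] M.r_neg)
  ultimately show "y \<in> N" by simp
qed (use assms submodule_minus in blast)

lemma submodule_smult_unit_iff:
  assumes "submodule N R M" "u \<in> Units R" "x \<in> carrier M"
  shows "u \<odot>\<^bsub>M\<^esub> x \<in> N \<longleftrightarrow> x \<in> N"
proof
  assume "u \<odot>\<^bsub>M\<^esub> x \<in> N"
  then have "inv u \<odot>\<^bsub>M\<^esub> (u \<odot>\<^bsub>M\<^esub> x) \<in> N"
    using assms submoduleE(4) R.Units_inv_closed by blast
  then show "x \<in> N" using assms smult_assoc1[of "inv u" u x]
    by (simp add: R.Units_closed R.Units_inv_closed)
qed (use assms submoduleE(4) in blast)

lemma minus_self: "x \<in> carrier M \<Longrightarrow> x \<ominus>\<^bsub>M\<^esub> x = \<zero>\<^bsub>M\<^esub>"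
  by (simp add: a_minus_def M.r_neg)

lemma minus_add_distr:
  "x \<in> carrier M \<Longrightarrow> y \<in> carrier M \<Longrightarrow> x' \<in> carrier M \<Longrightarrow> y' \<in> carrier M \<Longrightarrow>
    (x \<oplus>\<^bsub>M\<^esub> y) \<ominus>\<^bsub>M\<^esub> (x' \<oplus>\<^bsub>M\<^esub> y') = (x \<ominus>\<^bsub>M\<^esub> x') \<oplus>\<^bsub>M\<^esub> (y \<ominus>\<^bsub>M\<^esub> y')"
  by (simp add: a_minus_def M.minus_add M.a_ac)

lemma minus_minus_minus_cancel:
  "x \<in> carrier M \<Longrightarrow> y \<in> carrier M \<Longrightarrow> z \<in> carrier M \<Longrightarrow>
    (x \<ominus>\<^bsub>M\<^esub> y) \<ominus>\<^bsub>M\<^esub> (x \<ominus>\<^bsub>M\<^esub> z) = z \<ominus>\<^bsub>M\<^esub> y"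
proof -
  assume xyz: "x \<in> carrier M" "y \<in> carrier M" "z \<in> carrier M"
  then have "(x \<ominus>\<^bsub>M\<^esub> y) \<ominus>\<^bsub>M\<^esub> (x \<ominus>\<^bsub>M\<^esub> z) = (x \<oplus>\<^bsub>M\<^esub> \<ominus>\<^bsub>M\<^esub> x) \<oplus>\<^bsub>M\<^esub> (z \<oplus>\<^bsub>M\<^esub> \<ominus>\<^bsub>M\<^esub> y)"
    by (simp add: a_minus_def M.minus_add M.a_ac)
  then show ?thesis using xyz by (simp add: a_minus_def M.r_neg)
qed

lemma smult_minus_distr:
  "a \<in> carrier R \<Longrightarrow> x \<in> carrier M \<Longrightarrow> y \<in> carrier M \<Longrightarrow>
    a \<odot>\<^bsub>M\<^esub> (x \<ominus>\<^bsub>M\<^esub> y) = a \<odot>\<^bsub>M\<^esub> x \<ominus>\<^bsub>M\<^esub> a \<odot>\<^bsub>M\<^esub> y"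
  by (simp add: a_minus_def smult_r_distr smult_r_minus)

lemma minus_smult_distr:
  "a \<in> carrier R \<Longrightarrow> b \<in> carrier R \<Longrightarrow> x \<in> carrier M \<Longrightarrow>
    (a \<ominus> b) \<odot>\<^bsub>M\<^esub> x = a \<odot>\<^bsub>M\<^esub> x \<ominus>\<^bsub>M\<^esub> b \<odot>\<^bsub>M\<^esub> x"
  by (simp add: a_minus_def smult_l_distr smult_l_minus)

lemma finsum_const_smult:
  assumes "finite A" "z \<in> carrier M"
  shows "(\<Oplus>\<^bsub>M\<^esub>i\<in>A. z) = ([card A] \<cdot> \<one>) \<odot>\<^bsub>M\<^esub> z"
  using assms(1)
proof induction
  case (insert x F)
  then show ?case using assms(2)
    by (simp add: smult_l_distr M.a_comm)
qed (use assms(2) in simp)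

text \<open>Takes the place of induction over linear combinations: a linear condition, written as
  \<open>h x \<in> N\<close>, holds on a whole generated submodule as soon as it holds on the
  generators.\<close>

lemma submodule_preimage:
  assumes N: "submodule N R M" and "module R M'"
    and h: "\<And>x. x \<in> carrier M' \<Longrightarrow> h x \<in> carrier M"
    and add: "\<And>x y. x \<in> carrier M' \<Longrightarrow> y \<in> carrier M' \<Longrightarrow> h (x \<oplus>\<^bsub>M'\<^esub> y) = h x \<oplus>\<^bsub>M\<^esub> h y"
    and sm: "\<And>a x. a \<in> carrier R \<Longrightarrow> x \<in> carrier M' \<Longrightarrow> h (a \<odot>\<^bsub>M'\<^esub> x) = a \<odot>\<^bsub>M\<^esub> h x"
  shows "submodule {x \<in> carrier M'. h x \<in> N} R M'"
proof -
  interpret M': module R M' by fact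
  have m: "\<ominus>\<^bsub>M'\<^esub> x = (\<ominus> \<one>) \<odot>\<^bsub>M'\<^esub> x" if "x \<in> carrier M'" for x
    using M'.smult_l_minus[of \<one> x] that by simp
  have z: "h \<zero>\<^bsub>M'\<^esub> = \<zero>\<^bsub>M\<^esub>"
    using sm[of \<zero> "\<zero>\<^bsub>M'\<^esub>"] h[of "\<zero>\<^bsub>M'\<^esub>"] by simp
  show ?thesis
    by (rule M'.submoduleI) (auto simp: m z add sm submodule_zero[OF N] submoduleE[OF N])
qed

section \<open>Generated submodules, linear combinations and independence\<close>

lemma submodule_gen_least: "submodule N R M \<Longrightarrow> S \<subseteq> N \<Longrightarrow> submodule_gen R M S \<subseteq> N"
  by (auto simp: submodule_gen_def)

lemma submodule_gen_superset: "x \<in> S \<Longrightarrow> x \<in> submodule_gen R M S"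
  by (auto simp: submodule_gen_def)

lemma submodule_gen_mono: "S \<subseteq> T \<Longrightarrow> submodule_gen R M S \<subseteq> submodule_gen R M T"
  by (auto simp: submodule_gen_def)

text \<open>The finite combinations of the family form a submodule containing the family, so the
  intersection that defines \<open>submodule_gen\<close> is contained in the set of these
  combinations.\<close>

lemma submodule_gen_combination:
  assumes f: "f \<in> J \<rightarrow> carrier M" and z: "z \<in> submodule_gen R M (f ` J)"
  shows "\<exists>F c. finite F \<and> F \<subseteq> J \<and> c \<in> F \<rightarrow> carrier R \<and> z = (\<Oplus>\<^bsub>M\<^esub>j\<in>F. c j \<odot>\<^bsub>M\<^esub> f j)"
proof -
  \<comment> \<open>Coefficients are given on all of \<open>J\<close> and vanish off the finite
    support \<open>F\<close>, so that two combinations with different supports can be rewritten over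
    the union of the supports before they are added.\<close>
  let ?comb = "\<lambda>F c. finite F \<and> F \<subseteq> J \<and> c \<in> J \<rightarrow> carrier R \<and> (\<forall>j\<in>J - F. c j = \<zero>)"
  let ?sum = "\<lambda>F c. \<Oplus>\<^bsub>M\<^esub>j\<in>F. c j \<odot>\<^bsub>M\<^esub> f j"
  let ?C = "{?sum F c | F c. ?comb F c}"
  have ext: "?sum F c = ?sum G c" if "?comb F c" "finite G" "F \<subseteq> G" "G \<subseteq> J" for F G c
    by (rule M.add.finprod_mono_neutral_cong_left) (use that f in \<open>auto simp: Pi_iff\<close>)
  have sm: "a \<odot>\<^bsub>M\<^esub> x \<in> ?C" if "a \<in> carrier R" "x \<in> ?C" for a x
  proof -
    from that(2) obtain F c where x: "x = ?sum F c" and F: "?comb F c" by fast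
    have "a \<odot>\<^bsub>M\<^esub> x = (\<Oplus>\<^bsub>M\<^esub>j\<in>F. a \<odot>\<^bsub>M\<^esub> (c j \<odot>\<^bsub>M\<^esub> f j))"
      unfolding x using F that(1) f by (intro finsum_smult_ldistr) (auto simp: Pi_iff)
    also have "\<dots> = ?sum F (\<lambda>j. a \<otimes> c j)"
      using F that(1) f by (intro M.finsum_cong') (auto simp: Pi_iff smult_assoc1 subset_iff)
    finally show ?thesis using F that(1) by (intro CollectI exI[of _ F] exI[of _ "\<lambda>j. a \<otimes> c j"]) auto
  qed
  have ad: "x \<oplus>\<^bsub>M\<^esub> y \<in> ?C" if "x \<in> ?C" "y \<in> ?C" for x y
  proof -
    from that(1) obtain F c where x: "x = ?sum F c" and F: "?comb F c" by fast
    from that(2) obtain G d where y: "y = ?sum G d" and G: "?comb G d" by fast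
    have "x \<oplus>\<^bsub>M\<^esub> y = ?sum (F \<union> G) c \<oplus>\<^bsub>M\<^esub> ?sum (F \<union> G) d"
      unfolding x y using F G ext[of F c "F \<union> G"] ext[of G d "F \<union> G"] by simp
    also have "\<dots> = (\<Oplus>\<^bsub>M\<^esub>j\<in>F \<union> G. c j \<odot>\<^bsub>M\<^esub> f j \<oplus>\<^bsub>M\<^esub> d j \<odot>\<^bsub>M\<^esub> f j)"
      using F G f by (intro M.finsum_addf[symmetric]) (auto simp: Pi_iff subset_iff)
    also have "\<dots> = ?sum (F \<union> G) (\<lambda>j. c j \<oplus> d j)"
      using F G f by (intro M.finsum_cong') (auto simp: Pi_iff smult_l_distr subset_iff)
    finally show ?thesis using F G
      by (intro CollectI exI[of _ "F \<union> G"] exI[of _ "\<lambda>j. c j \<oplus> d j"]) auto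
  qed
  have C: "?C \<subseteq> carrier M" using f by (auto intro!: M.finsum_closed simp: Pi_iff subset_iff)
  have "submodule ?C R M"
  proof (rule submoduleI)
    show "\<zero>\<^bsub>M\<^esub> \<in> ?C"
      by (intro CollectI exI[of _ "{}"] exI[of _ "\<lambda>_. \<zero>"]) auto
    fix x assume x: "x \<in> ?C"
    have "\<ominus>\<^bsub>M\<^esub> x = (\<ominus> \<one>) \<odot>\<^bsub>M\<^esub> x"
      using smult_l_minus[of \<one> x] smult_one[of x] subsetD[OF C x] by simp
    then show "\<ominus>\<^bsub>M\<^esub> x \<in> ?C" using sm[OF _ x, of "\<ominus> \<one>"] by simp
  qed (fact C ad sm)+
  moreover have "f ` J \<subseteq> ?C"
  proof
    fix x assume "x \<in> f ` J"
    then obtain j where j: "j \<in> J" "x = f j" by blast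
    have s: "f j = ?sum {j} (\<lambda>i. if i = j then \<one> else \<zero>)"
      using j f by (subst M.finsum_insert) (auto simp: Pi_iff)
    show "x \<in> ?C"
      unfolding j(2)
      by (intro CollectI exI[of _ "{j}"] exI[of _ "\<lambda>i. if i = j then \<one> else \<zero>"] conjI s)
        (use j in auto)
  qed
  ultimately have "submodule_gen R M (f ` J) \<subseteq> ?C" by (rule submodule_gen_least)
  then have "z \<in> ?C" using z by (rule subsetD)
  then obtain F c where "z = ?sum F c" "?comb F c" by fast
  then show ?thesis by (intro exI[of _ F] exI[of _ c]) (auto simp: Pi_iff subset_iff)
qed

text \<open>Isolates one term of a combination: the remaining terms lie in \<open>N\<close> and can
  be subtracted. In the applications \<open>N\<close> is generated by all members of a family but
  one.\<close>

lemma finsum_remove_mem: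
  assumes "submodule N R M" "finite F" "j \<in> F" "c \<in> F \<rightarrow> carrier R" "f \<in> F \<rightarrow> carrier M"
    and "(\<Oplus>\<^bsub>M\<^esub>j\<in>F. c j \<odot>\<^bsub>M\<^esub> f j) \<in> N" and N: "\<And>i. i \<in> F \<Longrightarrow> i \<noteq> j \<Longrightarrow> f i \<in> N"
  shows "c j \<odot>\<^bsub>M\<^esub> f j \<in> N"
proof -
  let ?s = "\<Oplus>\<^bsub>M\<^esub>i\<in>F - {j}. c i \<odot>\<^bsub>M\<^esub> f i"
  have cl: "\<And>i. i \<in> F \<Longrightarrow> c i \<odot>\<^bsub>M\<^esub> f i \<in> carrier M" using assms by auto
  have "(\<Oplus>\<^bsub>M\<^esub>i\<in>insert j (F - {j}). c i \<odot>\<^bsub>M\<^esub> f i) = c j \<odot>\<^bsub>M\<^esub> f j \<oplus>\<^bsub>M\<^esub> ?s"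
    using assms(2,3) cl by (intro M.finsum_insert) auto
  then have 1: "c j \<odot>\<^bsub>M\<^esub> f j \<oplus>\<^bsub>M\<^esub> ?s \<in> N" using assms by (simp add: insert_absorb)
  have 2: "?s \<in> N"
    using assms by (intro submodule_finsum) (auto intro: submoduleE(4))
  have "(c j \<odot>\<^bsub>M\<^esub> f j \<oplus>\<^bsub>M\<^esub> ?s) \<ominus>\<^bsub>M\<^esub> ?s = c j \<odot>\<^bsub>M\<^esub> f j"
    using cl[OF assms(3)] submodule_carrier[OF assms(1) 2]
    by (simp add: a_minus_def M.a_assoc M.r_neg)
  then show ?thesis using submodule_minus[OF assms(1) 1 2] by simp
qed

text \<open>Writing the multiple of \<open>f j\<close> as a combination of the other vectors and
  moving it to the other side gives a relation whose coefficient at \<open>j\<close> is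
  \<open>\<ominus> a\<close>.\<close>

lemma lin_indep_family_smult_mem:
  assumes indep: "lin_indep_family R M J f" and f: "f \<in> J \<rightarrow> carrier M"
    and j: "j \<in> J" and a: "a \<in> carrier R"
    and mem: "a \<odot>\<^bsub>M\<^esub> f j \<in> submodule_gen R M (f ` (J - {j}))"
  shows "a = \<zero>"
proof -
  obtain F c where F: "finite F" "F \<subseteq> J - {j}" "c \<in> F \<rightarrow> carrier R"
    and eq: "a \<odot>\<^bsub>M\<^esub> f j = (\<Oplus>\<^bsub>M\<^esub>i\<in>F. c i \<odot>\<^bsub>M\<^esub> f i)"
    using submodule_gen_combination[OF _ mem] f by auto
  let ?d = "c(j := \<ominus> a)"
  have cl: "c i \<odot>\<^bsub>M\<^esub> f i \<in> carrier M" if "i \<in> F" for i using that F f by (auto simp: Pi_iff)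
  have fj: "f j \<in> carrier M" using f j by auto
  have "(\<Oplus>\<^bsub>M\<^esub>i\<in>insert j F. ?d i \<odot>\<^bsub>M\<^esub> f i) = (\<ominus> a) \<odot>\<^bsub>M\<^esub> f j \<oplus>\<^bsub>M\<^esub> (\<Oplus>\<^bsub>M\<^esub>i\<in>F. ?d i \<odot>\<^bsub>M\<^esub> f i)"
    using F cl fj a by (subst M.finsum_insert) (auto simp: Pi_iff)
  also have "(\<Oplus>\<^bsub>M\<^esub>i\<in>F. ?d i \<odot>\<^bsub>M\<^esub> f i) = a \<odot>\<^bsub>M\<^esub> f j"
    unfolding eq using F cl by (intro M.finsum_cong') auto
  also have "(\<ominus> a) \<odot>\<^bsub>M\<^esub> f j \<oplus>\<^bsub>M\<^esub> a \<odot>\<^bsub>M\<^esub> f j = \<zero>\<^bsub>M\<^esub>"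
    using a fj by (simp add: smult_l_minus M.l_neg)
  finally have "?d j = \<zero>"
    using indep[unfolded lin_indep_family_def, rule_format, of "insert j F" ?d j] F j a
    by (auto simp: Pi_iff subset_iff)
  then show ?thesis using a by simp
qed

text \<open>Condition \<open>A\<close> kills each \<open>Inl\<close> coefficient of a relation,
  because all other terms lie in the submodule generated by the other vectors. What is left is a
  relation inside the \<open>Inr\<close> part.\<close>

lemma lin_indep_family_Plus:
  fixes A :: "'i set" and B :: "'j set"
  assumes f: "f \<in> (A <+> B) \<rightarrow> carrier M"
    and A: "\<And>i a. i \<in> A \<Longrightarrow> a \<in> carrier R \<Longrightarrow>
      a \<odot>\<^bsub>M\<^esub> f (Inl i) \<in> submodule_gen R M (f ` ((A <+> B) - {Inl i})) \<Longrightarrow> a = \<zero>"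
    and B: "lin_indep_family R M B (\<lambda>i. f (Inr i))"
  shows "lin_indep_family R M (A <+> B) f"
  unfolding lin_indep_family_def
proof (intro allI impI, elim conjE)
  fix F c assume F: "finite F" "F \<subseteq> (A <+> B)" "c \<in> F \<rightarrow> carrier R"
    and sum: "(\<Oplus>\<^bsub>M\<^esub>j\<in>F. c j \<odot>\<^bsub>M\<^esub> f j) = \<zero>\<^bsub>M\<^esub>"
  have 1: "c (Inl i) = \<zero>" if i: "Inl i \<in> F" for i
  proof (rule A)
    have sub: "submodule (submodule_gen R M (f ` ((A <+> B) - {Inl i}))) R M"
      using f by (intro submodule_gen_submodule) auto
    show "c (Inl i) \<odot>\<^bsub>M\<^esub> f (Inl i) \<in> submodule_gen R M (f ` ((A <+> B) - {Inl i}))"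
      using F i f submodule_zero[OF sub]
      by (intro finsum_remove_mem[OF sub, where F=F]) (auto simp: sum intro: submodule_gen_superset)
  qed (use F i in auto)
  let ?G = "Inr -` F"
  have G: "finite ?G" using F by (simp add: finite_vimageI)
  have cl: "c j \<odot>\<^bsub>M\<^esub> f j \<in> carrier M" if "j \<in> F" for j using that F f by (auto simp: Pi_iff)
  have "(\<Oplus>\<^bsub>M\<^esub>j\<in>F. c j \<odot>\<^bsub>M\<^esub> f j) = (\<Oplus>\<^bsub>M\<^esub>j\<in>Inr ` ?G. c j \<odot>\<^bsub>M\<^esub> f j)"
  proof (rule M.add.finprod_mono_neutral_cong_right)
    fix i assume i: "i \<in> F - Inr ` ?G"
    then obtain k where "i = Inl k" by (cases i) auto
    then show "c i \<odot>\<^bsub>M\<^esub> f i = \<zero>\<^bsub>M\<^esub>" using 1 i F f by (auto simp: Pi_iff subset_iff)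
  qed (use F cl in auto)
  also have "\<dots> = (\<Oplus>\<^bsub>M\<^esub>i\<in>?G. c (Inr i) \<odot>\<^bsub>M\<^esub> f (Inr i))"
    using cl by (intro M.finsum_reindex) auto
  finally have "(\<Oplus>\<^bsub>M\<^esub>i\<in>?G. c (Inr i) \<odot>\<^bsub>M\<^esub> f (Inr i)) = \<zero>\<^bsub>M\<^esub>" using sum by simp
  moreover have "?G \<subseteq> B" using F(2) by auto
  moreover have "(\<lambda>i. c (Inr i)) \<in> ?G \<rightarrow> carrier R" using F(3) by auto
  ultimately have "\<forall>i\<in>?G. c (Inr i) = \<zero>"
    using B G unfolding lin_indep_family_def by blast
  then show "\<forall>j\<in>F. c j = \<zero>" using 1 by (metis sum.exhaust vimageI)
qed

lemma basis_family_cong: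
  assumes f: "basis_family R M J f" and eq: "\<And>j. j \<in> J \<Longrightarrow> f j = h j"
  shows "basis_family R M J h"
proof -
  have cl: "f \<in> J \<rightarrow> carrier M" using f by (simp add: basis_family_def)
  have "lin_indep_family R M J h"
    unfolding lin_indep_family_def
  proof (intro allI impI, elim conjE)
    fix F c assume F: "finite F" "F \<subseteq> J" "c \<in> F \<rightarrow> carrier R"
      and s: "(\<Oplus>\<^bsub>M\<^esub>j\<in>F. c j \<odot>\<^bsub>M\<^esub> h j) = \<zero>\<^bsub>M\<^esub>"
    have "(\<Oplus>\<^bsub>M\<^esub>j\<in>F. c j \<odot>\<^bsub>M\<^esub> f j) = (\<Oplus>\<^bsub>M\<^esub>j\<in>F. c j \<odot>\<^bsub>M\<^esub> h j)"
      using F cl eq by (intro M.finsum_cong') (auto simp: Pi_iff subset_iff)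
    then show "\<forall>j\<in>F. c j = \<zero>"
      using s F f unfolding basis_family_def lin_indep_family_def by simp
  qed
  moreover have "f ` J = h ` J" using eq by (simp cong: image_cong)
  moreover have "h \<in> J \<rightarrow> carrier M" using cl eq by (auto simp: Pi_iff)
  ultimately show ?thesis using f by (simp add: basis_family_def)
qed

lemma lin_indep_family_subset:
  "lin_indep_family R M J f \<Longrightarrow> J' \<subseteq> J \<Longrightarrow> lin_indep_family R M J' f"
  unfolding lin_indep_family_def by blast

section \<open>Bases of submodules and factor modules\<close>

lemma finsum_submodule:
  assumes "submodule N R M" "f \<in> F \<rightarrow> N"
  shows "finsum (M\<lparr>carrier := N\<rparr>) f F = finsum M f F"
proof -
  interpret N: module R "M\<lparr>carrier := N\<rparr>"
    using submodule.submodule_is_module[OF assms(1) module_axioms] .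
  show ?thesis
    using assms(2)
  proof (induction F rule: infinite_finite_induct)
    case (insert x F)
    have "f \<in> F \<rightarrow> carrier M" "f x \<in> carrier M"
      using insert.prems submodule_carrier[OF assms(1)] by auto
    then show ?case using insert N.finsum_insert[of F x f] by simp
  \<comment> \<open>Over an infinite index set both sums take the default value zero.\<close>
  qed (use N.finsum_infinite N.finsum_empty in auto)
qed

lemma submodule_submodule_iff:
  assumes N: "submodule N R M"
  shows "submodule P R (M\<lparr>carrier := N\<rparr>) \<longleftrightarrow> submodule P R M \<and> P \<subseteq> N"
proof -
  interpret N: module R "M\<lparr>carrier := N\<rparr>"
    using submodule.submodule_is_module[OF N module_axioms] .
  \<comment> \<open>The additive inverse depends on the carrier of the record. Both inverses are
    identified by comparing them with the multiple of \<open>x\<close> by minus one.\<close>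
  have neg: "\<ominus>\<^bsub>M\<lparr>carrier := N\<rparr>\<^esub> x = \<ominus>\<^bsub>M\<^esub> x" if "x \<in> N" for x
    using N.smult_l_minus[of \<one> x] smult_l_minus[of \<one> x] that submodule_carrier[OF N that]
      N.smult_one smult_one by simp
  show ?thesis
  proof
    assume P: "submodule P R (M\<lparr>carrier := N\<rparr>)"
    have PN: "P \<subseteq> N" using N.submoduleE(1)[OF P] by simp
    have "submodule P R M"
    proof (rule submoduleI)
      show "P \<subseteq> carrier M" using PN submodule_carrier[OF N] by auto
      show "\<zero>\<^bsub>M\<^esub> \<in> P" using N.submodule_zero[OF P] by simp
      show "\<ominus>\<^bsub>M\<^esub> a \<in> P" if "a \<in> P" for a
        using N.submoduleE(3)[OF P that] neg that PN by auto
    qed (use N.submoduleE(4,5)[OF P] in auto)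
    with PN show "submodule P R M \<and> P \<subseteq> N" by blast
  next
    assume P: "submodule P R M \<and> P \<subseteq> N"
    show "submodule P R (M\<lparr>carrier := N\<rparr>)"
    proof (rule N.submoduleI)
      show "\<ominus>\<^bsub>M\<lparr>carrier := N\<rparr>\<^esub> a \<in> P" if "a \<in> P" for a
        using submoduleE(3)[of P a] neg that P by auto
    qed (use P submoduleE(4,5)[of P] submodule_zero[of P] in auto)
  qed
qed

text \<open>Moves the work into \<open>M\<close>: finite sums in \<open>N\<close> are the same in
  both records, and the submodules of \<open>N\<close> are the submodules of \<open>M\<close>
  contained in \<open>N\<close>, so independence and generation can both be checked in
  \<open>M\<close>.\<close>

lemma basis_family_submoduleI:
  assumes N: "submodule N R M" and f: "f \<in> J \<rightarrow> N"
    and indep: "lin_indep_family R M J f" and gen: "N \<subseteq> submodule_gen R M (f ` J)"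
  shows "basis_family R (M\<lparr>carrier := N\<rparr>) J f"
proof -
  have "lin_indep_family R (M\<lparr>carrier := N\<rparr>) J f"
    unfolding lin_indep_family_def
  proof (intro allI impI, elim conjE)
    fix F c assume F: "finite F" "F \<subseteq> J" "c \<in> F \<rightarrow> carrier R"
      and s: "(\<Oplus>\<^bsub>M\<lparr>carrier := N\<rparr>\<^esub>j\<in>F. c j \<odot>\<^bsub>M\<lparr>carrier := N\<rparr>\<^esub> f j) = \<zero>\<^bsub>M\<lparr>carrier := N\<rparr>\<^esub>"
    have "(\<lambda>j. c j \<odot>\<^bsub>M\<^esub> f j) \<in> F \<rightarrow> N" using F f submoduleE(4)[OF N] by (auto simp: Pi_iff)
    then have "(\<Oplus>\<^bsub>M\<^esub>j\<in>F. c j \<odot>\<^bsub>M\<^esub> f j) = \<zero>\<^bsub>M\<^esub>" using s finsum_submodule[OF N, of "\<lambda>j. c j \<odot>\<^bsub>M\<^esub> f j"] by simp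
    then show "\<forall>j\<in>F. c j = \<zero>" using indep F unfolding lin_indep_family_def by blast
  qed
  moreover have "submodule_gen R (M\<lparr>carrier := N\<rparr>) (f ` J) = N"
  proof -
    have "f ` J \<subseteq> N" using f by auto
    then show ?thesis
      using gen N unfolding submodule_gen_def submodule_submodule_iff[OF N] by blast
  qed
  ultimately show ?thesis using f by (simp add: basis_family_def)
qed

text \<open>The hypotheses are the basis conditions pulled back along the coset map: a relation
  between cosets is a combination lying in \<open>N\<close>, and a submodule of the factor module
  corresponds to its preimage, which contains \<open>N\<close>.\<close>

lemma basis_family_factor_moduleI:
  fixes J :: "'j set"
  assumes N: "submodule N R M" and f: "f \<in> J \<rightarrow> carrier M"
    and indep: "\<And>F c. finite F \<Longrightarrow> F \<subseteq> J \<Longrightarrow> c \<in> F \<rightarrow> carrier R \<Longrightarrow>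
      (\<Oplus>\<^bsub>M\<^esub>j\<in>F. c j \<odot>\<^bsub>M\<^esub> f j) \<in> N \<Longrightarrow> \<forall>j\<in>F. c j = \<zero>"
    and gen: "\<And>P. submodule P R M \<Longrightarrow> N \<subseteq> P \<Longrightarrow> f ` J \<subseteq> P \<Longrightarrow> carrier M \<subseteq> P"
  shows "basis_family R (factor_module M N) J (\<lambda>j. N +>\<^bsub>M\<^esub> f j)"
proof -
  let ?Q = "factor_module M N"
  interpret N: submodule N R M by fact
  interpret N: abelian_subgroup N M
    by (rule abelian_subgroupI3) (auto intro: additive_subgroup.intro N.subgroup_axioms abelian_group_axioms)
  interpret Q: module R ?Q by (rule factor_module_module[OF N])
  have rep: "\<exists>x\<in>carrier M. X = N +>\<^bsub>M\<^esub> x" if "X \<in> carrier ?Q" for X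
    using that by (auto simp: factor_module_def A_RCOSETS_def')
  have cl: "N +>\<^bsub>M\<^esub> x \<in> carrier ?Q" if "x \<in> carrier M" for x
    using that by (auto simp: factor_module_def A_RCOSETS_def')
  have ad: "(N +>\<^bsub>M\<^esub> x) \<oplus>\<^bsub>?Q\<^esub> (N +>\<^bsub>M\<^esub> y) = N +>\<^bsub>M\<^esub> (x \<oplus>\<^bsub>M\<^esub> y)"
    if "x \<in> carrier M" "y \<in> carrier M" for x y
    using that N.a_rcos_sum by (simp add: factor_module_def)
  note sm = factor_module_module(2)[OF N]
  have zero: "\<zero>\<^bsub>?Q\<^esub> = N" by (simp add: factor_module_def)
  have coset_eq: "N +>\<^bsub>M\<^esub> x = N \<longleftrightarrow> x \<in> N" if "x \<in> carrier M" for x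
    using that N.a_rcos_self N.a_rcos_const by metis
  have sum: "(\<Oplus>\<^bsub>?Q\<^esub>j\<in>F. N +>\<^bsub>M\<^esub> g j) = N +>\<^bsub>M\<^esub> (\<Oplus>\<^bsub>M\<^esub>j\<in>F. g j)"
    if "finite F" "g \<in> F \<rightarrow> carrier M" for F and g :: "'j \<Rightarrow> _"
    using that
  proof (induction F)
    case empty
    then show ?case using coset_eq[of "\<zero>\<^bsub>M\<^esub>"] submodule_zero[OF N] by (simp add: zero)
  next
    case (insert x F)
    then have "g x \<in> carrier M" "g \<in> F \<rightarrow> carrier M" by auto
    moreover from this have "(\<lambda>j. N +>\<^bsub>M\<^esub> g j) \<in> F \<rightarrow> carrier ?Q" using cl by auto
    ultimately show ?case using insert by (simp add: ad cl)
  qed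
  have "lin_indep_family R ?Q J (\<lambda>j. N +>\<^bsub>M\<^esub> f j)"
    unfolding lin_indep_family_def
  proof (intro allI impI, elim conjE)
    fix F c assume F: "finite F" "F \<subseteq> J" "c \<in> F \<rightarrow> carrier R"
      and s: "(\<Oplus>\<^bsub>?Q\<^esub>j\<in>F. c j \<odot>\<^bsub>?Q\<^esub> (N +>\<^bsub>M\<^esub> f j)) = \<zero>\<^bsub>?Q\<^esub>"
    have fF: "f j \<in> carrier M" "c j \<in> carrier R" if "j \<in> F" for j using that f F by auto
    have "(\<Oplus>\<^bsub>?Q\<^esub>j\<in>F. c j \<odot>\<^bsub>?Q\<^esub> (N +>\<^bsub>M\<^esub> f j)) = (\<Oplus>\<^bsub>?Q\<^esub>j\<in>F. N +>\<^bsub>M\<^esub> (c j \<odot>\<^bsub>M\<^esub> f j))"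
      using fF by (intro Q.finsum_cong') (auto simp: sm intro!: cl)
    also have "\<dots> = N +>\<^bsub>M\<^esub> (\<Oplus>\<^bsub>M\<^esub>j\<in>F. c j \<odot>\<^bsub>M\<^esub> f j)"
      using fF F by (intro sum) auto
    finally have "(\<Oplus>\<^bsub>M\<^esub>j\<in>F. c j \<odot>\<^bsub>M\<^esub> f j) \<in> N"
      using s fF by (subst coset_eq[symmetric]) (auto simp: zero)
    then show "\<forall>j\<in>F. c j = \<zero>" using indep F by blast
  qed
  moreover have "carrier ?Q \<subseteq> P"
    if P: "submodule P R ?Q" "(\<lambda>j. N +>\<^bsub>M\<^esub> f j) ` J \<subseteq> P" for P
  proof -
    have "submodule {x \<in> carrier M. N +>\<^bsub>M\<^esub> x \<in> P} R M"
      by (rule Q.submodule_preimage[OF P(1) module_axioms]) (simp_all add: cl ad sm)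
    moreover have "N \<subseteq> {x \<in> carrier M. N +>\<^bsub>M\<^esub> x \<in> P}"
    proof
      fix x assume x: "x \<in> N"
      then have xM: "x \<in> carrier M" using submodule_carrier[OF N] by blast
      then have "N +>\<^bsub>M\<^esub> x = N" using coset_eq x by blast
      then show "x \<in> {x \<in> carrier M. N +>\<^bsub>M\<^esub> x \<in> P}"
        using xM Q.submodule_zero[OF P(1)] by (simp add: zero)
    qed
    ultimately have "carrier M \<subseteq> {x \<in> carrier M. N +>\<^bsub>M\<^esub> x \<in> P}"
      using gen P(2) f by (auto simp: Pi_iff)
    then show ?thesis using rep by fast
  qed
  then have "submodule_gen R ?Q ((\<lambda>j. N +>\<^bsub>M\<^esub> f j) ` J) = carrier ?Q"
    using f cl Q.carrier_is_submodule unfolding submodule_gen_def by (auto simp: Pi_iff)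
  ultimately show ?thesis
    using f cl by (auto simp: basis_family_def)
qed

end

section \<open>Averaging\<close>

locale averageable_action = module K M + W: group W
  for K (structure) and M (structure) and W +
  fixes t :: "'w \<Rightarrow> 'm \<Rightarrow> 'm"
  assumes finite_W: "finite (carrier W)"
    and order_unit: "[order W] \<cdot>\<^bsub>K\<^esub> \<one>\<^bsub>K\<^esub> \<in> Units K"
    and t_closed [simp]: "\<sigma> \<in> carrier W \<Longrightarrow> x \<in> carrier M \<Longrightarrow> t \<sigma> x \<in> carrier M"
    and t_add: "\<sigma> \<in> carrier W \<Longrightarrow> x \<in> carrier M \<Longrightarrow> y \<in> carrier M \<Longrightarrow>
      t \<sigma> (x \<oplus>\<^bsub>M\<^esub> y) = t \<sigma> x \<oplus>\<^bsub>M\<^esub> t \<sigma> y"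
    and t_smult: "\<sigma> \<in> carrier W \<Longrightarrow> a \<in> carrier K \<Longrightarrow> x \<in> carrier M \<Longrightarrow>
      t \<sigma> (a \<odot>\<^bsub>M\<^esub> x) = a \<odot>\<^bsub>M\<^esub> t \<sigma> x"
    and t_mult: "\<sigma> \<in> carrier W \<Longrightarrow> \<tau> \<in> carrier W \<Longrightarrow> x \<in> carrier M \<Longrightarrow>
      t (\<sigma> \<otimes>\<^bsub>W\<^esub> \<tau>) x = t \<sigma> (t \<tau> x)"
begin

definition diffs where
  "diffs = submodule_gen K M {z \<ominus>\<^bsub>M\<^esub> t \<sigma> z | \<sigma> z. \<sigma> \<in> carrier W \<and> z \<in> carrier M}"

definition fixed_points where
  "fixed_points = {z \<in> carrier M. \<forall>\<sigma>\<in>carrier W. t \<sigma> z = z}"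

text \<open>This is the operator of \<open>a_chi\<close> for the trivial character. When
  \<open>t\<close> is the action twisted by the inverse of \<open>\<chi>\<close>, it becomes the
  operator of \<open>a_chi\<close> for \<open>\<chi>\<close> and the original action.\<close>

definition avg where
  "avg z = inv\<^bsub>K\<^esub> ([order W] \<cdot>\<^bsub>K\<^esub> \<one>\<^bsub>K\<^esub>) \<odot>\<^bsub>M\<^esub> (\<Oplus>\<^bsub>M\<^esub>\<sigma>\<in>carrier W. t \<sigma> z)"

lemma inv_order_closed [simp]: "inv\<^bsub>K\<^esub> ([order W] \<cdot>\<^bsub>K\<^esub> \<one>\<^bsub>K\<^esub>) \<in> carrier K"
  using order_unit by simp

lemma inv_order_smult:
  "z \<in> carrier M \<Longrightarrow> inv\<^bsub>K\<^esub> ([order W] \<cdot>\<^bsub>K\<^esub> \<one>\<^bsub>K\<^esub>) \<odot>\<^bsub>M\<^esub> (\<Oplus>\<^bsub>M\<^esub>\<sigma>\<in>carrier W. z) = z"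
  using order_unit by (simp add: finsum_const_smult[OF finite_W] order_def smult_assoc1[symmetric])

lemma diffs_submodule: "submodule diffs K M"
  unfolding diffs_def by (rule submodule_gen_submodule) auto

lemma diffsI: "\<sigma> \<in> carrier W \<Longrightarrow> z \<in> carrier M \<Longrightarrow> z \<ominus>\<^bsub>M\<^esub> t \<sigma> z \<in> diffs"
  unfolding diffs_def by (rule submodule_gen_superset) auto

lemma avg_closed [simp]: "z \<in> carrier M \<Longrightarrow> avg z \<in> carrier M"
  by (auto simp: avg_def)

lemma avg_add: "x \<in> carrier M \<Longrightarrow> y \<in> carrier M \<Longrightarrow> avg (x \<oplus>\<^bsub>M\<^esub> y) = avg x \<oplus>\<^bsub>M\<^esub> avg y"
proof -
  assume xy: "x \<in> carrier M" "y \<in> carrier M"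
  have "(\<Oplus>\<^bsub>M\<^esub>\<sigma>\<in>carrier W. t \<sigma> (x \<oplus>\<^bsub>M\<^esub> y)) = (\<Oplus>\<^bsub>M\<^esub>\<sigma>\<in>carrier W. t \<sigma> x \<oplus>\<^bsub>M\<^esub> t \<sigma> y)"
    using xy by (intro M.finsum_cong') (auto simp: t_add)
  then show ?thesis using xy unfolding avg_def by (simp add: M.finsum_addf smult_r_distr)
qed

lemma avg_smult: "a \<in> carrier K \<Longrightarrow> x \<in> carrier M \<Longrightarrow> avg (a \<odot>\<^bsub>M\<^esub> x) = a \<odot>\<^bsub>M\<^esub> avg x"
proof -
  assume ax: "a \<in> carrier K" "x \<in> carrier M"
  have "(\<Oplus>\<^bsub>M\<^esub>\<sigma>\<in>carrier W. t \<sigma> (a \<odot>\<^bsub>M\<^esub> x)) = (\<Oplus>\<^bsub>M\<^esub>\<sigma>\<in>carrier W. a \<odot>\<^bsub>M\<^esub> t \<sigma> x)"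
    using ax by (intro M.finsum_cong') (auto simp: t_smult)
  also have "\<dots> = a \<odot>\<^bsub>M\<^esub> (\<Oplus>\<^bsub>M\<^esub>\<sigma>\<in>carrier W. t \<sigma> x)"
    using ax finite_W by (intro finsum_smult_ldistr[symmetric]) auto
  finally show ?thesis
    using ax unfolding avg_def by (simp add: smult_assoc1[symmetric] R.m_comm)
qed

lemma avg_minus: "x \<in> carrier M \<Longrightarrow> y \<in> carrier M \<Longrightarrow> avg (x \<ominus>\<^bsub>M\<^esub> y) = avg x \<ominus>\<^bsub>M\<^esub> avg y"
  using avg_smult[of "\<ominus>\<^bsub>K\<^esub> \<one>\<^bsub>K\<^esub>" y] avg_add[of x "\<ominus>\<^bsub>M\<^esub> y"]
  by (simp add: smult_l_minus a_minus_def)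

lemma avg_finsum:
  assumes "finite F" "g \<in> F \<rightarrow> carrier M"
  shows "avg (\<Oplus>\<^bsub>M\<^esub>j\<in>F. g j) = (\<Oplus>\<^bsub>M\<^esub>j\<in>F. avg (g j))"
  using assms
proof (induction F)
  case empty
  then show ?case using avg_smult[of "\<zero>\<^bsub>K\<^esub>" "\<zero>\<^bsub>M\<^esub>"] by simp
next
  case (insert x F)
  then have "g x \<in> carrier M" "g \<in> F \<rightarrow> carrier M" by auto
  moreover from this have "(\<lambda>j. avg (g j)) \<in> F \<rightarrow> carrier M" by (auto simp: Pi_iff)
  ultimately show ?case using insert by (simp add: avg_add)
qed

text \<open>Right translation by \<open>\<tau>\<close> permutes \<open>W\<close> and hence only
  reorders the sum.\<close>

lemma avg_t:
  assumes \<tau>: "\<tau> \<in> carrier W" and z: "z \<in> carrier M"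
  shows "avg (t \<tau> z) = avg z"
proof -
  have "(\<Oplus>\<^bsub>M\<^esub>\<sigma>\<in>carrier W. t \<sigma> (t \<tau> z)) = (\<Oplus>\<^bsub>M\<^esub>\<sigma>\<in>carrier W. t (\<sigma> \<otimes>\<^bsub>W\<^esub> \<tau>) z)"
    using assms by (intro M.finsum_cong') (auto simp: t_mult)
  also have "\<dots> = (\<Oplus>\<^bsub>M\<^esub>\<sigma>\<in>(\<lambda>\<sigma>. \<sigma> \<otimes>\<^bsub>W\<^esub> \<tau>) ` carrier W. t \<sigma> z)"
    using assms by (intro M.finsum_reindex[symmetric]) (auto intro: inj_onI)
  also have "(\<lambda>\<sigma>. \<sigma> \<otimes>\<^bsub>W\<^esub> \<tau>) ` carrier W = carrier W"
  proof (intro equalityI subsetI)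
    fix \<sigma> assume "\<sigma> \<in> carrier W"
    then show "\<sigma> \<in> (\<lambda>\<sigma>. \<sigma> \<otimes>\<^bsub>W\<^esub> \<tau>) ` carrier W"
      using \<tau> by (intro image_eqI[of _ _ "\<sigma> \<otimes>\<^bsub>W\<^esub> inv\<^bsub>W\<^esub> \<tau>"]) (auto simp: W.m_assoc)
  qed (use \<tau> in auto)
  finally show ?thesis by (simp add: avg_def)
qed

lemma avg_fixed: "z \<in> fixed_points \<Longrightarrow> avg z = z"
proof -
  assume z: "z \<in> fixed_points"
  then have "(\<Oplus>\<^bsub>M\<^esub>\<sigma>\<in>carrier W. t \<sigma> z) = (\<Oplus>\<^bsub>M\<^esub>\<sigma>\<in>carrier W. z)"
    by (intro M.finsum_cong') (auto simp: fixed_points_def)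
  then show ?thesis using z inv_order_smult by (simp add: avg_def fixed_points_def)
qed

lemma t_finsum:
  assumes "finite F" "g \<in> F \<rightarrow> carrier M" and \<sigma>: "\<sigma> \<in> carrier W"
  shows "t \<sigma> (\<Oplus>\<^bsub>M\<^esub>j\<in>F. g j) = (\<Oplus>\<^bsub>M\<^esub>j\<in>F. t \<sigma> (g j))"
  using assms(1,2)
proof (induction F)
  case empty
  then show ?case using t_smult[of \<sigma> "\<zero>\<^bsub>K\<^esub>" "\<zero>\<^bsub>M\<^esub>"] \<sigma> by simp
next
  case (insert x F)
  then have "g x \<in> carrier M" "g \<in> F \<rightarrow> carrier M" by auto
  moreover from this have "(\<lambda>j. t \<sigma> (g j)) \<in> F \<rightarrow> carrier M" using \<sigma> by (auto simp: Pi_iff)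
  ultimately show ?case using insert \<sigma> by (simp add: t_add)
qed

text \<open>Applying \<open>t \<tau>\<close> to the sum amounts to a left translation of
  \<open>W\<close>, which again only reorders the terms.\<close>

lemma avg_in_fixed_points:
  assumes z: "z \<in> carrier M"
  shows "avg z \<in> fixed_points"
proof -
  have "t \<tau> (avg z) = avg z" if \<tau>: "\<tau> \<in> carrier W" for \<tau>
  proof -
    have "t \<tau> (\<Oplus>\<^bsub>M\<^esub>\<sigma>\<in>carrier W. t \<sigma> z) = (\<Oplus>\<^bsub>M\<^esub>\<sigma>\<in>carrier W. t \<tau> (t \<sigma> z))"
      using z \<tau> finite_W by (intro t_finsum) auto
    also have "\<dots> = (\<Oplus>\<^bsub>M\<^esub>\<sigma>\<in>carrier W. t (\<tau> \<otimes>\<^bsub>W\<^esub> \<sigma>) z)"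
      using z \<tau> by (intro M.finsum_cong') (auto simp: t_mult)
    also have "\<dots> = (\<Oplus>\<^bsub>M\<^esub>\<sigma>\<in>(\<lambda>\<sigma>. \<tau> \<otimes>\<^bsub>W\<^esub> \<sigma>) ` carrier W. t \<sigma> z)"
      using z \<tau> by (intro M.finsum_reindex[symmetric]) (auto intro: inj_onI)
    also have "(\<lambda>\<sigma>. \<tau> \<otimes>\<^bsub>W\<^esub> \<sigma>) ` carrier W = carrier W"
      using W.surj_const_mult \<tau> by blast
    finally show ?thesis using z \<tau> by (simp add: avg_def t_smult)
  qed
  then show ?thesis using z by (simp add: fixed_points_def)
qed

lemma minus_avg_in_diffs:
  assumes z: "z \<in> carrier M"
  shows "z \<ominus>\<^bsub>M\<^esub> avg z \<in> diffs"
proof -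
  let ?n = "inv\<^bsub>K\<^esub> ([order W] \<cdot>\<^bsub>K\<^esub> \<one>\<^bsub>K\<^esub>)"
  let ?d = "\<Oplus>\<^bsub>M\<^esub>\<sigma>\<in>carrier W. z \<ominus>\<^bsub>M\<^esub> t \<sigma> z" and ?s = "\<Oplus>\<^bsub>M\<^esub>\<sigma>\<in>carrier W. t \<sigma> z"
  have cl: "?d \<in> carrier M" "?s \<in> carrier M" using z by (auto intro!: M.finsum_closed)
  have "?d \<oplus>\<^bsub>M\<^esub> ?s = (\<Oplus>\<^bsub>M\<^esub>\<sigma>\<in>carrier W. (z \<ominus>\<^bsub>M\<^esub> t \<sigma> z) \<oplus>\<^bsub>M\<^esub> t \<sigma> z)"
    using z by (intro M.finsum_addf[symmetric]) auto
  also have "\<dots> = (\<Oplus>\<^bsub>M\<^esub>\<sigma>\<in>carrier W. z)"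
    using z by (intro M.finsum_cong') (auto simp: a_minus_def M.a_assoc M.l_neg)
  finally have "?n \<odot>\<^bsub>M\<^esub> ?d \<oplus>\<^bsub>M\<^esub> avg z = z"
    using cl inv_order_smult[OF z] by (simp add: avg_def smult_r_distr[symmetric])
  then have "z \<ominus>\<^bsub>M\<^esub> avg z = (?n \<odot>\<^bsub>M\<^esub> ?d \<oplus>\<^bsub>M\<^esub> avg z) \<ominus>\<^bsub>M\<^esub> avg z" by simp
  also have "\<dots> = ?n \<odot>\<^bsub>M\<^esub> ?d"
    using cl z by (simp add: a_minus_def M.a_assoc M.r_neg)
  also have "?n \<odot>\<^bsub>M\<^esub> ?d \<in> diffs"
    using diffs_submodule diffsI z by (intro submoduleE(4) submodule_finsum) auto
  finally show ?thesis .
qed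

text \<open>By \<open>avg_t\<close> the average kills the generators of \<open>diffs\<close>.
  Conversely, an element of average zero equals its own difference with its average, so
  \<open>minus_avg_in_diffs\<close> applies.\<close>

lemma mem_diffs_iff: "z \<in> carrier M \<Longrightarrow> z \<in> diffs \<longleftrightarrow> avg z = \<zero>\<^bsub>M\<^esub>"
proof
  have sub: "submodule {\<zero>\<^bsub>M\<^esub>} K M" by (rule submoduleI) auto
  have "submodule {x \<in> carrier M. avg x \<in> {\<zero>\<^bsub>M\<^esub>}} K M"
    by (rule submodule_preimage[OF sub module_axioms]) (simp_all add: avg_add avg_smult)
  then have "diffs \<subseteq> {x \<in> carrier M. avg x \<in> {\<zero>\<^bsub>M\<^esub>}}"
    unfolding diffs_def
    by (rule submodule_gen_least) (auto simp: avg_minus avg_t minus_self)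
  then show "avg z = \<zero>\<^bsub>M\<^esub>" if "z \<in> diffs" using that by auto
  show "z \<in> diffs" if "avg z = \<zero>\<^bsub>M\<^esub>" "z \<in> carrier M"
    using minus_avg_in_diffs[of z] that M.minus_equality[of "\<zero>\<^bsub>M\<^esub>" "\<zero>\<^bsub>M\<^esub>"]
    by (simp add: a_minus_def)
qed

lemma fixed_points_submodule: "submodule fixed_points K M"
proof (rule submoduleI)
  show "\<zero>\<^bsub>M\<^esub> \<in> fixed_points" using avg_in_fixed_points[of "\<zero>\<^bsub>M\<^esub>"] 
      avg_smult[of "\<zero>\<^bsub>K\<^esub>" "\<zero>\<^bsub>M\<^esub>"] by simp
  show "\<ominus>\<^bsub>M\<^esub> x \<in> fixed_points" if "x \<in> fixed_points" for x
    using that t_smult[of _ "\<ominus>\<^bsub>K\<^esub> \<one>\<^bsub>K\<^esub>" x] by (auto simp: fixed_points_def smult_l_minus)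
qed (auto simp: fixed_points_def t_add t_smult)

text \<open>Works because \<open>avg\<close> induces an isomorphism from \<open>M / diffs\<close> onto the fixed points.\<close>

lemma basis_family_avgI:
  assumes f: "f \<in> J \<rightarrow> carrier M"
    and indep: "\<And>F c. finite F \<Longrightarrow> F \<subseteq> J \<Longrightarrow> c \<in> F \<rightarrow> carrier K \<Longrightarrow>
      (\<Oplus>\<^bsub>M\<^esub>j\<in>F. c j \<odot>\<^bsub>M\<^esub> f j) \<in> diffs \<Longrightarrow> \<forall>j\<in>F. c j = \<zero>\<^bsub>K\<^esub>"
    and gen: "\<And>P. submodule P K M \<Longrightarrow> diffs \<subseteq> P \<Longrightarrow> f ` J \<subseteq> P \<Longrightarrow> carrier M \<subseteq> P"
  shows "basis_family K (M\<lparr>carrier := fixed_points\<rparr>) J (\<lambda>j. avg (f j))"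
proof (rule basis_family_submoduleI[OF fixed_points_submodule])
  show "(\<lambda>j. avg (f j)) \<in> J \<rightarrow> fixed_points" using f avg_in_fixed_points by (auto simp: Pi_iff)
  show "lin_indep_family K M J (\<lambda>j. avg (f j))"
    unfolding lin_indep_family_def
  proof (intro allI impI, elim conjE)
    fix F c assume F: "finite F" "F \<subseteq> J" "c \<in> F \<rightarrow> carrier K"
      and s: "(\<Oplus>\<^bsub>M\<^esub>j\<in>F. c j \<odot>\<^bsub>M\<^esub> avg (f j)) = \<zero>\<^bsub>M\<^esub>"
    have fF: "f j \<in> carrier M" "c j \<in> carrier K" if "j \<in> F" for j using that f F by auto
    have "avg (\<Oplus>\<^bsub>M\<^esub>j\<in>F. c j \<odot>\<^bsub>M\<^esub> f j) = (\<Oplus>\<^bsub>M\<^esub>j\<in>F. avg (c j \<odot>\<^bsub>M\<^esub> f j))"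
      using F fF by (intro avg_finsum) auto
    also have "\<dots> = (\<Oplus>\<^bsub>M\<^esub>j\<in>F. c j \<odot>\<^bsub>M\<^esub> avg (f j))"
      using fF by (intro M.finsum_cong') (auto simp: avg_smult)
    \<comment> \<open>The average of this combination is zero, which by \<open>mem_diffs_iff\<close>
      turns a relation between averages into a relation modulo \<open>diffs\<close>.\<close>
    finally have "(\<Oplus>\<^bsub>M\<^esub>j\<in>F. c j \<odot>\<^bsub>M\<^esub> f j) \<in> diffs"
      using s fF by (subst mem_diffs_iff) auto
    then show "\<forall>j\<in>F. c j = \<zero>\<^bsub>K\<^esub>" using indep F by blast
  qed
  let ?S = "submodule_gen K M ((\<lambda>j. avg (f j)) ` J)"
  have sub: "submodule ?S K M" using f by (intro submodule_gen_submodule) (auto simp: Pi_iff)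
  \<comment> \<open>The elements whose average lies in \<open>?S\<close> form a submodule. It
    contains \<open>diffs\<close>, where averages vanish, and every \<open>f j\<close>, so by
    \<open>gen\<close> it is all of \<open>M\<close>. Fixed points are their own averages and
    therefore lie in \<open>?S\<close>.\<close>
  have "submodule {x \<in> carrier M. avg x \<in> ?S} K M"
    by (rule submodule_preimage[OF sub module_axioms]) (simp_all add: avg_add avg_smult)
  moreover have "diffs \<subseteq> {x \<in> carrier M. avg x \<in> ?S}"
  proof
    fix x assume x: "x \<in> diffs"
    then have "x \<in> carrier M" using submodule_carrier[OF diffs_submodule] by blast
    then show "x \<in> {x \<in> carrier M. avg x \<in> ?S}"
      using mem_diffs_iff x submodule_zero[OF sub] by simp
  qed
  moreover have "f ` J \<subseteq> {x \<in> carrier M. avg x \<in> ?S}"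
    using f by (auto intro!: submodule_gen_superset)
  ultimately have "carrier M \<subseteq> {x \<in> carrier M. avg x \<in> ?S}" using gen by blast
  then have "avg z \<in> ?S" if "z \<in> fixed_points" for z
    using that by (auto simp: fixed_points_def)
  then show "fixed_points \<subseteq> ?S" using avg_fixed by auto
qed

end

section \<open>Monomial actions\<close>

lemma (in module) basis_family_closed: "basis_family R M I e \<Longrightarrow> i \<in> I \<Longrightarrow> e i \<in> carrier M"
  by (auto simp: basis_family_def)

text \<open>In coordinates with respect to the basis, \<open>a\<close> annihilates every coefficient
  of \<open>z\<close>. Over a domain a single nonzero coefficient then forces
  \<open>a = \<zero>\<close>.\<close>

lemma (in module) smult_eq_zeroD:
  assumes dom: "domain R" and basis: "basis_family R M I e"
    and a: "a \<in> carrier R" and z: "z \<in> carrier M" and az: "a \<odot>\<^bsub>M\<^esub> z = \<zero>\<^bsub>M\<^esub>"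
  shows "a = \<zero> \<or> z = \<zero>\<^bsub>M\<^esub>"
proof (rule disjCI)
  interpret domain R by fact
  assume nz: "z \<noteq> \<zero>\<^bsub>M\<^esub>"
  have e: "e \<in> I \<rightarrow> carrier M" using basis by (simp add: basis_family_def)
  have "z \<in> submodule_gen R M (e ` I)" using z basis by (simp add: basis_family_def)
  from submodule_gen_combination[OF e this]
  obtain F c where F: "finite F" "F \<subseteq> I" "c \<in> F \<rightarrow> carrier R"
    and zF: "z = (\<Oplus>\<^bsub>M\<^esub>j\<in>F. c j \<odot>\<^bsub>M\<^esub> e j)" by auto
  have cF: "c j \<in> carrier R" "e j \<in> carrier M" if "j \<in> F" for j using that F e by auto
  have "a \<odot>\<^bsub>M\<^esub> z = (\<Oplus>\<^bsub>M\<^esub>j\<in>F. a \<odot>\<^bsub>M\<^esub> (c j \<odot>\<^bsub>M\<^esub> e j))"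
    unfolding zF using F a cF by (intro finsum_smult_ldistr) auto
  also have "\<dots> = (\<Oplus>\<^bsub>M\<^esub>j\<in>F. (a \<otimes> c j) \<odot>\<^bsub>M\<^esub> e j)"
    using a cF by (intro M.finsum_cong') (auto simp: smult_assoc1)
  finally have "(\<Oplus>\<^bsub>M\<^esub>j\<in>F. (a \<otimes> c j) \<odot>\<^bsub>M\<^esub> e j) = \<zero>\<^bsub>M\<^esub>" using az by simp
  moreover have "(\<lambda>j. a \<otimes> c j) \<in> F \<rightarrow> carrier R" using a cF by auto
  ultimately have ac: "\<forall>j\<in>F. a \<otimes> c j = \<zero>"
    using basis F unfolding basis_family_def lin_indep_family_def by blast
  have "\<exists>j\<in>F. c j \<noteq> \<zero>"
  proof (rule ccontr)
    assume "\<not> (\<exists>j\<in>F. c j \<noteq> \<zero>)"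
    then have "z = \<zero>\<^bsub>M\<^esub>" unfolding zF using cF by (intro M.add.finprod_one_eqI) auto
    with nz show False by simp
  qed
  then show "a = \<zero>" using ac a cF integral by blast
qed

locale monomial_action = averageable_action K M W t + domain K + I: group_action W I \<phi>
  for K (structure) and M (structure) and W :: "'w monoid" and t I \<phi> +
  fixes g e Istar Wrep
  assumes g_unit: "i \<in> I \<Longrightarrow> \<sigma> \<in> carrier W \<Longrightarrow> g i \<sigma> \<in> Units K"
    and basis: "basis_family K M I e"
    and monomial: "i \<in> I \<Longrightarrow> \<sigma> \<in> carrier W \<Longrightarrow> t \<sigma> (e i) = g i \<sigma> \<odot>\<^bsub>M\<^esub> e (\<phi> \<sigma> i)"
    and Istar: "orbit_transversal W I \<phi> Istar"
    and Wrep: "i \<in> I \<Longrightarrow> left_transversal W (stabilizer W \<phi> i) (Wrep i)"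
begin

text \<open>Becomes \<open>index_chi\<close> when \<open>g\<close> is the product of
  \<open>\<gamma>\<close> with the inverse of \<open>\<chi>\<close>.\<close>

definition J where "J = {i \<in> I. \<forall>\<sigma>\<in>stabilizer W \<phi> i. g i \<sigma> = \<one>\<^bsub>K\<^esub>}"

definition S where "S = (SIGMA i:Istar. Wrep i - stabilizer W \<phi> i)"

text \<open>The sum type keeps the index sets of the two families apart, so that their union is a
  single family. Independence is proved on the larger index set \<open>S <+> Istar\<close>, which
  serves both for the basis of \<open>diffs\<close> and for independence modulo
  \<open>diffs\<close>.\<close>

definition v where "v = case_sum
  (\<lambda>(i, \<sigma>). e i \<ominus>\<^bsub>M\<^esub> g i \<sigma> \<odot>\<^bsub>M\<^esub> e (\<phi> \<sigma> i)) (\<lambda>i. e i)"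

lemma e_closed [simp]: "i \<in> I \<Longrightarrow> e i \<in> carrier M"
  using basis_family_closed[OF basis] .

lemma g_closed [simp]: "i \<in> I \<Longrightarrow> \<sigma> \<in> carrier W \<Longrightarrow> g i \<sigma> \<in> carrier K"
  using g_unit by blast

lemma \<phi>_closed [simp]: "i \<in> I \<Longrightarrow> \<sigma> \<in> carrier W \<Longrightarrow> \<phi> \<sigma> i \<in> I"
  using I.element_image by blast

lemma Istar_I: "k \<in> Istar \<Longrightarrow> k \<in> I"
  using Istar by (auto simp: orbit_transversal_def)

lemma Wrep_W: "i \<in> I \<Longrightarrow> \<sigma> \<in> Wrep i \<Longrightarrow> \<sigma> \<in> carrier W"
  using Wrep by (auto simp: left_transversal_def)

lemma stabilizerD: "\<sigma> \<in> stabilizer W \<phi> i \<Longrightarrow> \<sigma> \<in> carrier W \<and> \<phi> \<sigma> i = i"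
  by (simp add: stabilizer_def)

section \<open>Orbit and coset representatives\<close>

lemma orbit_representative:
  assumes "i \<in> I" obtains k \<tau> where "k \<in> Istar" "\<tau> \<in> carrier W" "i = \<phi> \<tau> k"
proof -
  have "orbit W \<phi> i \<in> orbits W I \<phi>" using assms by (auto simp: orbits_def)
  then obtain k where k: "k \<in> Istar" "k \<in> orbit W \<phi> i"
    using Istar unfolding orbit_transversal_def by blast
  then have "i \<in> orbit W \<phi> k" using I.orbit_sym assms Istar_I by blast
  then show thesis using that k by (auto simp: orbit_def)
qed

text \<open>The common point puts \<open>k\<close> and \<open>k'\<close> into one orbit, which meets
  \<open>Istar\<close> only once.\<close>

lemma orbit_representative_unique:
  assumes k: "k \<in> Istar" "k' \<in> Istar" and \<sigma>: "\<sigma> \<in> carrier W" "\<tau> \<in> carrier W"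
    and eq: "\<phi> \<sigma> k = \<phi> \<tau> k'"
  shows "k = k'"
proof -
  note kI = k[THEN Istar_I]
  have "\<phi> \<sigma> k \<in> orbit W \<phi> k" "\<phi> \<sigma> k \<in> orbit W \<phi> k'"
    using \<sigma>(1) unfolding orbit_def by (blast, use \<sigma>(2) eq in blast)
  then have "k' \<in> orbit W \<phi> k"
    using I.orbit_sym[of k' "\<phi> \<sigma> k"] I.orbit_trans[of k "\<phi> \<sigma> k" k'] kI \<sigma> by simp
  moreover have "k \<in> orbit W \<phi> k" using I.orbit_refl kI by blast
  moreover have "orbit W \<phi> k \<in> orbits W I \<phi>" using kI by (auto simp: orbits_def)
  ultimately show ?thesis using Istar k unfolding orbit_transversal_def by blast
qed

lemma coset_representative:
  assumes i: "i \<in> I" and \<rho>: "\<rho> \<in> carrier W"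
  obtains \<sigma> h where "\<sigma> \<in> Wrep i" "h \<in> stabilizer W \<phi> i" "\<rho> = \<sigma> \<otimes>\<^bsub>W\<^esub> h"
proof -
  have "\<rho> <#\<^bsub>W\<^esub> stabilizer W \<phi> i \<in> lcosets\<^bsub>W\<^esub> (stabilizer W \<phi> i)"
    using \<rho> by (auto simp: LCOSETS_def)
  then obtain \<sigma> where \<sigma>: "\<sigma> \<in> Wrep i" "\<sigma> \<in> \<rho> <#\<^bsub>W\<^esub> stabilizer W \<phi> i"
    using Wrep[OF i] unfolding left_transversal_def by blast
  then obtain h where h: "h \<in> stabilizer W \<phi> i" "\<sigma> = \<rho> \<otimes>\<^bsub>W\<^esub> h"
    by (auto simp: l_coset_def)
  have hW: "h \<in> carrier W" using h stabilizerD by blast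
  have "inv\<^bsub>W\<^esub> h \<in> stabilizer W \<phi> i"
    using subgroup.m_inv_closed[OF I.stabilizer_subgroup[OF i] h(1)] .
  moreover have "\<rho> = \<sigma> \<otimes>\<^bsub>W\<^esub> inv\<^bsub>W\<^esub> h" using h(2) hW \<rho> by (simp add: W.m_assoc)
  ultimately show thesis using that \<sigma>(1) by blast
qed

text \<open>Equal images of \<open>i\<close> put \<open>\<tau>\<close> into the left coset of
  \<open>\<sigma>\<close> modulo the stabilizer, and the transversal meets that coset only
  once.\<close>

lemma coset_representative_unique:
  assumes i: "i \<in> I" and \<sigma>: "\<sigma> \<in> Wrep i" "\<tau> \<in> Wrep i" and eq: "\<phi> \<sigma> i = \<phi> \<tau> i"
  shows "\<sigma> = \<tau>"
proof -
  note W = \<sigma>[THEN Wrep_W[OF i]]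
  have "\<phi> (inv\<^bsub>W\<^esub> \<sigma> \<otimes>\<^bsub>W\<^esub> \<tau>) i = \<phi> (inv\<^bsub>W\<^esub> \<sigma>) (\<phi> \<sigma> i)"
    using W i eq by (simp add: I.composition_rule)
  also have "\<dots> = i" using I.orbit_sym_aux[OF W(1) i refl] .
  finally have "inv\<^bsub>W\<^esub> \<sigma> \<otimes>\<^bsub>W\<^esub> \<tau> \<in> stabilizer W \<phi> i" using W by (simp add: stabilizer_def)
  moreover have "\<tau> = \<sigma> \<otimes>\<^bsub>W\<^esub> (inv\<^bsub>W\<^esub> \<sigma> \<otimes>\<^bsub>W\<^esub> \<tau>)" using W by (simp add: W.m_assoc[symmetric])
  ultimately have "\<tau> \<in> \<sigma> <#\<^bsub>W\<^esub> stabilizer W \<phi> i" unfolding l_coset_def by blast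
  moreover have "\<sigma> \<in> \<sigma> <#\<^bsub>W\<^esub> stabilizer W \<phi> i"
    using W.lcos_self[OF W(1) I.stabilizer_subgroup[OF i]] .
  moreover have "\<sigma> <#\<^bsub>W\<^esub> stabilizer W \<phi> i \<in> lcosets\<^bsub>W\<^esub> (stabilizer W \<phi> i)"
    using W by (auto simp: LCOSETS_def)
  ultimately show ?thesis using Wrep[OF i] \<sigma> unfolding left_transversal_def by blast
qed

lemma avg_eq_zero:
  assumes i: "i \<in> I - J"
  shows "avg (e i) = \<zero>\<^bsub>M\<^esub>"
proof -
  obtain \<sigma> where \<sigma>: "\<sigma> \<in> stabilizer W \<phi> i" "g i \<sigma> \<noteq> \<one>\<^bsub>K\<^esub>"
    using i by (auto simp: J_def)
  note \<sigma>' = stabilizerD[OF \<sigma>(1)]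
  \<comment> \<open>Since \<open>\<sigma>\<close> fixes \<open>i\<close>, the vector
    \<open>t \<sigma> (e i)\<close> is a multiple of \<open>e i\<close>, and it has the same
    average.\<close>
  have "avg (e i) = avg (t \<sigma> (e i))" using \<sigma>' i by (simp add: avg_t)
  also have "\<dots> = g i \<sigma> \<odot>\<^bsub>M\<^esub> avg (e i)" using \<sigma>' i by (simp add: monomial avg_smult)
  finally have "(g i \<sigma> \<ominus>\<^bsub>K\<^esub> \<one>\<^bsub>K\<^esub>) \<odot>\<^bsub>M\<^esub> avg (e i) = \<zero>\<^bsub>M\<^esub>"
    using \<sigma>' i by (simp add: minus_smult_distr minus_self)
  moreover have "g i \<sigma> \<ominus>\<^bsub>K\<^esub> \<one>\<^bsub>K\<^esub> \<noteq> \<zero>\<^bsub>K\<^esub>"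
  proof
    assume "g i \<sigma> \<ominus>\<^bsub>K\<^esub> \<one>\<^bsub>K\<^esub> = \<zero>\<^bsub>K\<^esub>"
    moreover have "(g i \<sigma> \<ominus>\<^bsub>K\<^esub> \<one>\<^bsub>K\<^esub>) \<oplus>\<^bsub>K\<^esub> \<one>\<^bsub>K\<^esub> = g i \<sigma>"
      using \<sigma>' i by (simp add: a_minus_def R.a_assoc R.l_neg)
    ultimately show False using \<sigma>(2) by simp
  qed
  ultimately show ?thesis
    using smult_eq_zeroD[OF domain_axioms basis, of "g i \<sigma> \<ominus>\<^bsub>K\<^esub> \<one>\<^bsub>K\<^esub>" "avg (e i)"] \<sigma>' i by auto
qed

section \<open>Linear independence of the family \<open>v\<close>\<close>

lemma S_D: "(i, \<sigma>) \<in> S \<Longrightarrow> i \<in> Istar \<and> i \<in> I \<and> \<sigma> \<in> Wrep i \<and> \<sigma> \<in> carrier W \<and> \<phi> \<sigma> i \<notin> Istar"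
proof -
  assume "(i, \<sigma>) \<in> S"
  then have i: "i \<in> Istar" "\<sigma> \<in> Wrep i" "\<sigma> \<notin> stabilizer W \<phi> i" by (auto simp: S_def)
  note iI = Istar_I[OF i(1)]
  note \<sigma> = Wrep_W[OF iI i(2)]
  have "\<phi> \<sigma> i \<notin> Istar"
  proof
    assume st: "\<phi> \<sigma> i \<in> Istar"
    \<comment> \<open>The unit of \<open>W\<close> is inserted so that
      \<open>orbit_representative_unique\<close> can compare \<open>i\<close> with
      \<open>\<phi> \<sigma> i\<close>, both then in \<open>Istar\<close>.\<close>
    have "\<phi> \<sigma> i = \<phi> \<one>\<^bsub>W\<^esub> (\<phi> \<sigma> i)"
      using I.id_eq_one iI \<sigma> by (metis \<phi>_closed restrict_apply')
    from orbit_representative_unique[OF i(1) st \<sigma> _ this] have "\<phi> \<sigma> i = i" by simp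
    then show False using i(3) \<sigma> by (simp add: stabilizer_def)
  qed
  with i iI \<sigma> show ?thesis by blast
qed

lemma v_Inl: "(i, \<sigma>) \<in> S \<Longrightarrow> v (Inl (i, \<sigma>)) = e i \<ominus>\<^bsub>M\<^esub> t \<sigma> (e i)"
  using S_D by (simp add: v_def monomial)

lemma v_Inr: "v (Inr i) = e i"
  by (simp add: v_def)

lemma v_closed: "v \<in> S <+> Istar \<rightarrow> carrier M"
  using S_D Istar_I by (auto simp: v_Inl v_Inr)

lemma v_Inl_mem_others:
  assumes i: "(i, \<sigma>) \<in> S" and a: "a \<in> carrier K"
    and mem: "a \<odot>\<^bsub>M\<^esub> v (Inl (i, \<sigma>)) \<in> submodule_gen K M (v ` ((S <+> Istar) - {Inl (i, \<sigma>)}))"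
  shows "a = \<zero>\<^bsub>K\<^esub>"
proof -
  note iD = S_D[OF i]
  let ?E = "e ` (I - {\<phi> \<sigma> i})"
  let ?P = "submodule_gen K M ?E"
  have P: "submodule ?P K M" by (intro submodule_gen_submodule) auto
  have eP: "e j \<in> ?P" if "j \<in> I" "j \<noteq> \<phi> \<sigma> i" for j
    using that by (intro submodule_gen_superset) auto
  have "v x \<in> ?P" if x: "x \<in> (S <+> Istar) - {Inl (i, \<sigma>)}" for x
  proof (cases x)
    case (Inr k)
    then show ?thesis using x iD Istar_I by (auto simp: v_Inr intro!: eP)
  next
    case (Inl y)
    then obtain k \<tau> where k: "x = Inl (k, \<tau>)" "(k, \<tau>) \<in> S" "(k, \<tau>) \<noteq> (i, \<sigma>)"
      using x by (cases y) auto
    note kD = S_D[OF k(2)]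
    \<comment> \<open>Equality would first give \<open>k = i\<close> by uniqueness in orbits, and
      then \<open>\<tau> = \<sigma>\<close> by uniqueness in cosets.\<close>
    have "\<phi> \<tau> k \<noteq> \<phi> \<sigma> i"
      using orbit_representative_unique[of k i \<tau> \<sigma>] coset_representative_unique[of i \<tau> \<sigma>] kD iD k(3)
      by auto
    \<comment> \<open>The index \<open>k\<close> lies in \<open>Istar\<close> while
      \<open>\<phi> \<sigma> i\<close> does not, by \<open>S_D\<close>, so they differ.\<close>
    then have "e k \<in> ?P" "e (\<phi> \<tau> k) \<in> ?P" using kD iD by (auto intro!: eP)
    then have "e k \<ominus>\<^bsub>M\<^esub> g k \<tau> \<odot>\<^bsub>M\<^esub> e (\<phi> \<tau> k) \<in> ?P"
      using kD by (intro submodule_minus[OF P] submoduleE(4)[OF P]) auto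
    then show ?thesis using k kD by (simp add: v_def)
  qed
  then have "submodule_gen K M (v ` ((S <+> Istar) - {Inl (i, \<sigma>)})) \<subseteq> ?P"
    by (intro submodule_gen_least[OF P]) auto
  then have "a \<odot>\<^bsub>M\<^esub> v (Inl (i, \<sigma>)) \<in> ?P" using mem by blast
  moreover have "a \<odot>\<^bsub>M\<^esub> v (Inl (i, \<sigma>)) = a \<odot>\<^bsub>M\<^esub> e i \<ominus>\<^bsub>M\<^esub> (a \<otimes>\<^bsub>K\<^esub> g i \<sigma>) \<odot>\<^bsub>M\<^esub> e (\<phi> \<sigma> i)"
    using iD a by (simp add: v_def smult_minus_distr smult_assoc1)
  moreover have "a \<odot>\<^bsub>M\<^esub> e i \<in> ?P" using iD a by (intro submoduleE(4)[OF P] eP) auto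
  ultimately have "(a \<otimes>\<^bsub>K\<^esub> g i \<sigma>) \<odot>\<^bsub>M\<^esub> e (\<phi> \<sigma> i) \<in> ?P"
    using submodule_minus_left_iff[OF P] iD a by simp
  then have "a \<otimes>\<^bsub>K\<^esub> g i \<sigma> = \<zero>\<^bsub>K\<^esub>"
    using basis iD a by (intro lin_indep_family_smult_mem[of I e "\<phi> \<sigma> i"]) (auto simp: basis_family_def)
  moreover have "g i \<sigma> \<noteq> \<zero>\<^bsub>K\<^esub>"
    using g_unit[of i \<sigma>] iD by (metis Units_r_inv Units_inv_closed l_null one_not_zero)
  ultimately show ?thesis using integral[of a "g i \<sigma>"] iD a by auto
qed

lemma lin_indep_v: "lin_indep_family K M (S <+> Istar) v"
proof (rule lin_indep_family_Plus[OF v_closed])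
  show "lin_indep_family K M Istar (\<lambda>i. v (Inr i))"
    unfolding v_Inr
    using basis Istar_I by (auto simp: basis_family_def intro: lin_indep_family_subset[of I])
next
  fix x a
  assume *: "x \<in> S" "a \<in> carrier K"
    "a \<odot>\<^bsub>M\<^esub> v (Inl x) \<in> submodule_gen K M (v ` ((S <+> Istar) - {Inl x}))"
  obtain i \<sigma> where "x = (i, \<sigma>)" by (cases x)
  with * show "a = \<zero>\<^bsub>K\<^esub>" using v_Inl_mem_others[of i \<sigma> a] by blast
qed

section \<open>Generators of \<open>diffs\<close> and bases modulo \<open>diffs\<close>\<close>

lemma v_in_diffs: "v ` (S <+> (Istar \<inter> (I - J))) \<subseteq> diffs"
proof
  fix x assume "x \<in> v ` (S <+> (Istar \<inter> (I - J)))"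
  then consider i \<sigma> where "(i, \<sigma>) \<in> S" "x = v (Inl (i, \<sigma>))" | i where "i \<in> I - J" "x = v (Inr i)"
    by auto
  then show "x \<in> diffs"
  proof cases
    case 1
    then show ?thesis using S_D by (auto simp: v_Inl intro!: diffsI)
  next
    case 2
    then show ?thesis using avg_eq_zero mem_diffs_iff by (auto simp: v_Inr)
  qed
qed

text \<open>The generators of \<open>diffs\<close> are reduced in stages: from arbitrary
  \<open>z\<close> to basis vectors \<open>e i\<close>, from these to \<open>e k\<close> with
  \<open>k\<close> in the orbit transversal, and from arbitrary group elements to coset
  representatives. The proof builds this up in the reverse order.\<close>

lemma diffs_subset_gen_v: "diffs \<subseteq> submodule_gen K M (v ` (S <+> (Istar \<inter> (I - J))))" (is "_ \<subseteq> ?N")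
proof -
  have N: "submodule ?N K M"
    using v_closed by (intro submodule_gen_submodule) (auto simp: Pi_iff)
  have gen: "e k \<ominus>\<^bsub>M\<^esub> t \<sigma> (e k) \<in> ?N" if "(k, \<sigma>) \<in> S" for k \<sigma>
    using that by (subst v_Inl[symmetric]) (auto intro!: submodule_gen_superset)
  have e0: "e k \<in> ?N" if "k \<in> Istar" "k \<notin> J" for k
    using that Istar_I by (subst v_Inr[symmetric]) (auto intro!: submodule_gen_superset)
  have d: "e k \<ominus>\<^bsub>M\<^esub> t \<rho> (e k) \<in> ?N" if k: "k \<in> Istar" and \<rho>: "\<rho> \<in> carrier W" for k \<rho>
  proof -
    note kI = Istar_I[OF k]
    obtain \<sigma> h where \<sigma>: "\<sigma> \<in> Wrep k" and h: "h \<in> stabilizer W \<phi> k" and eq: "\<rho> = \<sigma> \<otimes>\<^bsub>W\<^esub> h"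
      using coset_representative[OF kI \<rho>] .
    note hW = stabilizerD[OF h] and \<sigma>W = Wrep_W[OF kI \<sigma>]
    \<comment> \<open>As \<open>h\<close> fixes \<open>k\<close>, passing from \<open>\<rho>\<close>
      to its coset representative \<open>\<sigma>\<close> costs only the scalar
      \<open>g k h\<close>.\<close>
    have t\<rho>: "t \<rho> (e k) = g k h \<odot>\<^bsub>M\<^esub> t \<sigma> (e k)"
      using eq hW \<sigma>W kI t_mult[of \<sigma> h "e k"] by (simp add: monomial[of k h] t_smult)
    have st: "t \<sigma> (e k) = g k \<sigma> \<odot>\<^bsub>M\<^esub> e k" if "\<sigma> \<in> stabilizer W \<phi> k"
      using that kI stabilizerD[OF that] by (simp add: monomial)
    have S: "(k, \<sigma>) \<in> S" if "\<sigma> \<notin> stabilizer W \<phi> k" using that k \<sigma> by (simp add: S_def)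
    show ?thesis
    proof (cases "k \<in> J")
      \<comment> \<open>For \<open>k\<close> in \<open>J\<close> the scalar is one, so the
        difference is a member of the family, or zero when \<open>\<sigma>\<close> stabilizes
        \<open>k\<close>.\<close>
      case True
      then have "t \<rho> (e k) = t \<sigma> (e k)" using t\<rho> h kI \<sigma>W by (simp add: J_def)
      moreover have "t \<sigma> (e k) = e k" if "\<sigma> \<in> stabilizer W \<phi> k"
        using st[OF that] True that kI by (simp add: J_def)
      ultimately show ?thesis using gen S submodule_zero[OF N] minus_self kI
        by (cases "\<sigma> \<in> stabilizer W \<phi> k") simp_all
    next
      \<comment> \<open>For \<open>k\<close> outside \<open>J\<close> the vector \<open>e k\<close>
        is itself a member of the family, so it suffices to place \<open>t \<sigma> (e k)\<close> in
        \<open>?N\<close>.\<close>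
      case False
      have ek: "e k \<in> ?N" using e0 k False by blast
      have "t \<sigma> (e k) \<in> ?N"
      proof (cases "\<sigma> \<in> stabilizer W \<phi> k")
        case True
        then show ?thesis using st kI \<sigma>W submoduleE(4)[OF N _ ek] by simp
      next
        case False
        then show ?thesis using gen[OF S] submodule_minus_left_iff[OF N ek] kI \<sigma>W by simp
      qed
      then show ?thesis
        unfolding t\<rho> using submodule_minus[OF N ek] submoduleE(4)[OF N] hW kI by simp
    qed
  qed
  have di: "e i \<ominus>\<^bsub>M\<^esub> t \<sigma> (e i) \<in> ?N" if i: "i \<in> I" and \<sigma>: "\<sigma> \<in> carrier W" for i \<sigma>
  proof -
    obtain k \<tau> where k: "k \<in> Istar" and \<tau>: "\<tau> \<in> carrier W" and eq: "i = \<phi> \<tau> k"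
      using orbit_representative[OF i] .
    note kI = Istar_I[OF k]
    \<comment> \<open>Up to the unit \<open>g k \<tau>\<close>, the vector \<open>e i\<close> is
      \<open>t \<tau> (e k)\<close>. The difference at \<open>i\<close> thus becomes, up to this
      unit, the difference of two differences at \<open>k\<close>.\<close>
    have t\<tau>: "t \<tau> (e k) = g k \<tau> \<odot>\<^bsub>M\<^esub> e i" using eq kI \<tau> by (simp add: monomial)
    have "g k \<tau> \<odot>\<^bsub>M\<^esub> (e i \<ominus>\<^bsub>M\<^esub> t \<sigma> (e i)) = t \<tau> (e k) \<ominus>\<^bsub>M\<^esub> t (\<sigma> \<otimes>\<^bsub>W\<^esub> \<tau>) (e k)"
      using t\<tau> t_mult[OF \<sigma> \<tau>, of "e k"] kI i \<sigma> \<tau> by (simp add: smult_minus_distr t_smult)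
    also have "\<dots> = (e k \<ominus>\<^bsub>M\<^esub> t (\<sigma> \<otimes>\<^bsub>W\<^esub> \<tau>) (e k)) \<ominus>\<^bsub>M\<^esub> (e k \<ominus>\<^bsub>M\<^esub> t \<tau> (e k))"
      using kI \<sigma> \<tau> by (simp add: minus_minus_minus_cancel)
    also have "\<dots> \<in> ?N" using \<sigma> \<tau> by (intro submodule_minus[OF N d d] k) auto
    finally show ?thesis
      using submodule_smult_unit_iff[OF N g_unit[OF kI \<tau>]] i \<sigma> by simp
  qed
  have "z \<ominus>\<^bsub>M\<^esub> t \<sigma> z \<in> ?N" if \<sigma>: "\<sigma> \<in> carrier W" and z: "z \<in> carrier M" for \<sigma> z
  proof -
    \<comment> \<open>The condition is linear in \<open>z\<close>, so checking it on the basis is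
      enough.\<close>
    have "submodule {z \<in> carrier M. z \<ominus>\<^bsub>M\<^esub> t \<sigma> z \<in> ?N} K M"
      using \<sigma> by (intro submodule_preimage[OF N module_axioms])
        (simp_all add: t_add t_smult smult_minus_distr minus_add_distr)
    then have "submodule_gen K M (e ` I) \<subseteq> {z \<in> carrier M. z \<ominus>\<^bsub>M\<^esub> t \<sigma> z \<in> ?N}"
      using di \<sigma> by (intro submodule_gen_least) auto
    then show ?thesis using z basis by (auto simp: basis_family_def)
  qed
  then show ?thesis
    unfolding diffs_def by (intro submodule_gen_least[OF N]) auto
qed

lemma lin_indep_mod_diffs:
  assumes F: "finite F" "F \<subseteq> Istar \<inter> J" "c \<in> F \<rightarrow> carrier K"
    and s: "(\<Oplus>\<^bsub>M\<^esub>j\<in>F. c j \<odot>\<^bsub>M\<^esub> e j) \<in> diffs"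
  shows "\<forall>j\<in>F. c j = \<zero>\<^bsub>K\<^esub>"
proof
  fix j assume j: "j \<in> F"
  let ?R = "v ` ((S <+> Istar) - {Inr j})"
  let ?N = "submodule_gen K M ?R"
  have N: "submodule ?N K M"
    using v_closed by (intro submodule_gen_submodule) (auto simp: Pi_iff)
  have FI: "i \<in> I" if "i \<in> F" for i using that F Istar_I by blast
  have "v ` (S <+> (Istar \<inter> (I - J))) \<subseteq> ?R" using F j by (intro image_mono) auto
  then have "diffs \<subseteq> ?N" using diffs_subset_gen_v submodule_gen_mono by blast
  moreover have "e i \<in> ?N" if "i \<in> F" "i \<noteq> j" for i
    using that F by (subst v_Inr[symmetric]) (auto intro!: submodule_gen_superset)
  ultimately have "c j \<odot>\<^bsub>M\<^esub> e j \<in> ?N"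
    using s F FI j by (intro finsum_remove_mem[OF N, where F=F]) auto
  then have "c j \<odot>\<^bsub>M\<^esub> v (Inr j) \<in> ?N" by (simp add: v_Inr)
  then show "c j = \<zero>\<^bsub>K\<^esub>"
    using lin_indep_family_smult_mem[OF lin_indep_v v_closed, of "Inr j" "c j"] F j by auto
qed

text \<open>Modulo \<open>diffs\<close>, \<open>e k\<close> agrees with
  \<open>t \<tau> (e k)\<close>, a unit multiple of \<open>e (\<phi> \<tau> k)\<close>, so the
  transversal vectors suffice. Those with index outside \<open>J\<close> have average zero and lie
  in \<open>diffs\<close> already.\<close>

lemma generate_mod_diffs:
  assumes P: "submodule P K M" and "diffs \<subseteq> P" "e ` (Istar \<inter> J) \<subseteq> P"
  shows "carrier M \<subseteq> P"
proof -
  have st: "e k \<in> P" if k: "k \<in> Istar" for k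
  proof (cases "k \<in> J")
    case False
    then have "e k \<in> diffs" using Istar_I[OF k] avg_eq_zero[of k] by (simp add: mem_diffs_iff)
    then show ?thesis using assms by blast
  qed (use k assms in blast)
  have "e i \<in> P" if i: "i \<in> I" for i
  proof -
    obtain k \<tau> where k: "k \<in> Istar" and \<tau>: "\<tau> \<in> carrier W" and eq: "i = \<phi> \<tau> k"
      using orbit_representative[OF i] .
    note kI = Istar_I[OF k]
    have "e k \<ominus>\<^bsub>M\<^esub> t \<tau> (e k) \<in> P" using diffsI \<tau> kI assms by auto
    then have "t \<tau> (e k) \<in> P" using submodule_minus_left_iff[OF P st[OF k]] \<tau> kI by simp
    then show ?thesis
      using submodule_smult_unit_iff[OF P g_unit[OF kI \<tau>]] kI \<tau> eq i by (simp add: monomial)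
  qed
  then have "submodule_gen K M (e ` I) \<subseteq> P" by (intro submodule_gen_least[OF P]) auto
  then show ?thesis using basis by (simp add: basis_family_def)
qed

lemma basis_diffs:
  "basis_family K (M\<lparr>carrier := diffs\<rparr>) (S <+> (Istar \<inter> (I - J))) v"
proof (rule basis_family_submoduleI[OF diffs_submodule _ _ diffs_subset_gen_v])
  show "v \<in> (S <+> (Istar \<inter> (I - J))) \<rightarrow> diffs" using v_in_diffs by blast
  show "lin_indep_family K M (S <+> (Istar \<inter> (I - J))) v"
    using lin_indep_v by (rule lin_indep_family_subset) auto
qed

lemma basis_fixed_points:
  "basis_family K (M\<lparr>carrier := fixed_points\<rparr>) (Istar \<inter> J) (\<lambda>j. avg (e j))"
  by (rule basis_family_avgI[OF _ lin_indep_mod_diffs generate_mod_diffs]) (auto simp: Istar_I)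

lemma basis_coinvariants:
  "basis_family K (factor_module M diffs) (Istar \<inter> J) (\<lambda>j. diffs +>\<^bsub>M\<^esub> e j)"
  by (rule basis_family_factor_moduleI[OF diffs_submodule _ lin_indep_mod_diffs generate_mod_diffs])
    (auto simp: Istar_I)

end

section \<open>Reduction of a general character to the trivial one\<close>

theorem theorem5:
  fixes K :: "'k ring" and W :: "'w monoid" and M :: "('k, 'm) module"
    and I :: "'i set" and \<phi> :: "'w \<Rightarrow> 'i \<Rightarrow> 'i" and \<gamma> :: "'i \<Rightarrow> 'w \<Rightarrow> 'k"
    and e :: "'i \<Rightarrow> 'm" and act :: "'w \<Rightarrow> 'm \<Rightarrow> 'm" and \<chi> :: "'w \<Rightarrow> 'k"
    and Istar :: "'i set" and Wrep :: "'i \<Rightarrow> 'w set"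
  assumes K: "domain K"
    and W: "group W" "finite (carrier W)"
    and order_unit: "[order W] \<cdot>\<^bsub>K\<^esub> \<one>\<^bsub>K\<^esub> \<in> Units K"
    and \<chi>: "\<chi> \<in> hom W (units_of K)"
    and I: "group_action W I \<phi>"
    and \<gamma>_unit: "\<And>i \<sigma>. i \<in> I \<Longrightarrow> \<sigma> \<in> carrier W \<Longrightarrow> \<gamma> i \<sigma> \<in> Units K"
    and \<gamma>_mult: "\<And>i \<sigma> \<tau>. i \<in> I \<Longrightarrow> \<sigma> \<in> carrier W \<Longrightarrow> \<tau> \<in> carrier W
        \<Longrightarrow> \<gamma> i (\<sigma> \<otimes>\<^bsub>W\<^esub> \<tau>) = \<gamma> (\<phi> \<tau> i) \<sigma> \<otimes>\<^bsub>K\<^esub> \<gamma> i \<tau>"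
    and M: "module K M"
    and basis: "basis_family K M I e"
    and act: "linear_action K W M act"
    and monomial: "\<And>i \<sigma>. i \<in> I \<Longrightarrow> \<sigma> \<in> carrier W
        \<Longrightarrow> act \<sigma> (e i) = \<gamma> i \<sigma> \<odot>\<^bsub>M\<^esub> e (\<phi> \<sigma> i)"
    and Istar: "orbit_transversal W I \<phi> Istar"
    and Wrep: "\<And>i. i \<in> I \<Longrightarrow> left_transversal W (stabilizer W \<phi> i) (Wrep i)"
  shows "basis_family K (M\<lparr>carrier := chi_diffs K W M act \<chi>\<rparr>)
           ((SIGMA i:Istar. Wrep i - stabilizer W \<phi> i) <+> (Istar \<inter> (I - index_chi W I \<phi> \<gamma> \<chi>)))
           (case_sum
             (\<lambda>(i, \<sigma>). e i \<ominus>\<^bsub>M\<^esub> (inv\<^bsub>K\<^esub> (\<chi> \<sigma>) \<otimes>\<^bsub>K\<^esub> \<gamma> i \<sigma>) \<odot>\<^bsub>M\<^esub> e (\<phi> \<sigma> i))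
             (\<lambda>i. e i))
       \<and> basis_family K (M\<lparr>carrier := chi_invs W M act \<chi>\<rparr>)
           (Istar \<inter> index_chi W I \<phi> \<gamma> \<chi>)
           (\<lambda>j. ga_act W M act (a_chi K W \<chi>) (e j))
       \<and> basis_family K (factor_module M (chi_diffs K W M act \<chi>))
           (Istar \<inter> index_chi W I \<phi> \<gamma> \<chi>)
           (\<lambda>j. chi_diffs K W M act \<chi> +>\<^bsub>M\<^esub> e j)"
proof -
  interpret domain K by fact
  interpret A: linear_action K W M act by fact
  interpret W: group W by fact
  have \<chi>_unit: "\<chi> \<sigma> \<in> Units K" if "\<sigma> \<in> carrier W" for \<sigma>
    using \<chi> that by (auto simp: hom_def units_of_def)
  have \<chi>_mult: "\<chi> (\<sigma> \<otimes>\<^bsub>W\<^esub> \<tau>) = \<chi> \<sigma> \<otimes>\<^bsub>K\<^esub> \<chi> \<tau>" if "\<sigma> \<in> carrier W" "\<tau> \<in> carrier W" for \<sigma> \<tau>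
    using \<chi> that by (auto simp: hom_def units_of_def)
  have act_closed [simp]: "act \<sigma> z \<in> carrier M" if "\<sigma> \<in> carrier W" "z \<in> carrier M" for \<sigma> z
    using A.element_image that by blast
  have e_closed: "e i \<in> carrier M" if "i \<in> I" for i
    using A.basis_family_closed[OF basis that] .
  have \<phi>_closed: "\<phi> \<sigma> i \<in> I" if "\<sigma> \<in> carrier W" "i \<in> I" for \<sigma> i
    using group_action.element_image[OF I] that by blast
  have K_closed [simp]: "\<chi> \<sigma> \<in> carrier K" "inv\<^bsub>K\<^esub> (\<chi> \<sigma>) \<in> carrier K" if "\<sigma> \<in> carrier W" for \<sigma>
    using \<chi>_unit[OF that] by auto
  \<comment> \<open>The twisted action is again monomial in the same basis, with coefficients
    \<open>g\<close>.\<close>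
  define t where "t \<sigma> z = inv\<^bsub>K\<^esub> (\<chi> \<sigma>) \<odot>\<^bsub>M\<^esub> act \<sigma> z" for \<sigma> z
  define g where "g = (\<lambda>i \<sigma>. inv\<^bsub>K\<^esub> (\<chi> \<sigma>) \<otimes>\<^bsub>K\<^esub> \<gamma> i \<sigma>)"
  have av: "averageable_action K M W t"
  proof (intro averageable_action.intro averageable_action_axioms.intro)
    fix \<sigma> \<tau> x assume *: "\<sigma> \<in> carrier W" "\<tau> \<in> carrier W" "x \<in> carrier M"
    \<comment> \<open>Since \<open>K\<close> is commutative, the inverse of \<open>\<chi>\<close> is
      again multiplicative, and hence so is \<open>t\<close>.\<close>
    have "inv\<^bsub>K\<^esub> (\<chi> \<sigma> \<otimes>\<^bsub>K\<^esub> \<chi> \<tau>) = inv\<^bsub>K\<^esub> (\<chi> \<sigma>) \<otimes>\<^bsub>K\<^esub> inv\<^bsub>K\<^esub> (\<chi> \<tau>)"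
      using \<chi>_unit *
      by (intro comm_inv_char) (auto simp: m_ac Units_closed)
    then show "t (\<sigma> \<otimes>\<^bsub>W\<^esub> \<tau>) x = t \<sigma> (t \<tau> x)"
      using * by (simp add: t_def \<chi>_mult A.composition_rule A.act_smult A.smult_assoc1)
  next
    fix \<sigma> a x assume *: "\<sigma> \<in> carrier W" "a \<in> carrier K" "x \<in> carrier M"
    then show "t \<sigma> (a \<odot>\<^bsub>M\<^esub> x) = a \<odot>\<^bsub>M\<^esub> t \<sigma> x"
      by (simp add: t_def A.act_smult A.smult_assoc1[symmetric] m_comm)
  qed (simp_all add: M W order_unit t_def A.act_add A.smult_r_distr)
  interpret T: monomial_action K M W t I \<phi> g e Istar Wrep
  proof (intro monomial_action.intro monomial_action_axioms.intro)
    fix i \<sigma> assume *: "i \<in> I" "\<sigma> \<in> carrier W"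
    show "g i \<sigma> \<in> Units K" using * \<chi>_unit \<gamma>_unit by (simp add: g_def)
    show "t \<sigma> (e i) = g i \<sigma> \<odot>\<^bsub>M\<^esub> e (\<phi> \<sigma> i)"
      using * \<gamma>_unit[OF *] by (simp add: t_def g_def monomial A.smult_assoc1 e_closed \<phi>_closed Units_closed)
  qed (fact av K I basis Istar | erule Wrep)+
  \<comment> \<open>The generators belonging to \<open>act\<close> and to \<open>t\<close> differ by
    the unit \<open>\<chi> \<sigma>\<close>, so they generate the same submodule.\<close>
  have t_diff: "\<chi> \<sigma> \<odot>\<^bsub>M\<^esub> (z \<ominus>\<^bsub>M\<^esub> t \<sigma> z) = \<chi> \<sigma> \<odot>\<^bsub>M\<^esub> z \<ominus>\<^bsub>M\<^esub> act \<sigma> z"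
    if "\<sigma> \<in> carrier W" "z \<in> carrier M" for \<sigma> z
    using that \<chi>_unit by (simp add: t_def A.smult_minus_distr A.smult_assoc1[symmetric])
  have diffs: "chi_diffs K W M act \<chi> = T.diffs"
  proof
    note sub = A.chi_diffs_submodule[OF \<chi>]
    show "chi_diffs K W M act \<chi> \<subseteq> T.diffs"
      unfolding chi_diffs_def
      by (rule A.submodule_gen_least[OF T.diffs_submodule])
        (auto simp: t_diff[symmetric] intro!: A.submoduleE(4)[OF T.diffs_submodule] T.diffsI)
    have "z \<ominus>\<^bsub>M\<^esub> t \<sigma> z \<in> chi_diffs K W M act \<chi>" if "\<sigma> \<in> carrier W" "z \<in> carrier M" for \<sigma> z
    proof -
      have "\<chi> \<sigma> \<odot>\<^bsub>M\<^esub> z \<ominus>\<^bsub>M\<^esub> act \<sigma> z \<in> chi_diffs K W M act \<chi>"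
        unfolding chi_diffs_def using that by (intro A.submodule_gen_superset) auto
      then show ?thesis
        using A.submodule_smult_unit_iff[OF sub \<chi>_unit] that by (simp add: t_diff[symmetric])
    qed
    then show "T.diffs \<subseteq> chi_diffs K W M act \<chi>"
      unfolding T.diffs_def by (intro A.submodule_gen_least[OF sub]) auto
  qed
  have "t \<sigma> z = z \<longleftrightarrow> act \<sigma> z = \<chi> \<sigma> \<odot>\<^bsub>M\<^esub> z" if "\<sigma> \<in> carrier W" "z \<in> carrier M" for \<sigma> z
  proof
    assume "t \<sigma> z = z"
    then have "\<chi> \<sigma> \<odot>\<^bsub>M\<^esub> t \<sigma> z = \<chi> \<sigma> \<odot>\<^bsub>M\<^esub> z" by simp
    then show "act \<sigma> z = \<chi> \<sigma> \<odot>\<^bsub>M\<^esub> z"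
      using that \<chi>_unit by (simp add: t_def A.smult_assoc1[symmetric])
  qed (use that \<chi>_unit in \<open>simp add: t_def A.smult_assoc1[symmetric]\<close>)
  then have fixed_points: "chi_invs W M act \<chi> = T.fixed_points"
    by (auto simp: chi_invs_def T.fixed_points_def)
  have avg: "ga_act W M act (a_chi K W \<chi>) z = T.avg z" if z: "z \<in> carrier M" for z
  proof -
    \<comment> \<open>Moving the inverse of the group order inside the sum produces the coefficients
      of \<open>a_chi\<close>.\<close>
    have "T.avg z = (\<Oplus>\<^bsub>M\<^esub>\<sigma>\<in>carrier W. inv\<^bsub>K\<^esub> ([order W] \<cdot>\<^bsub>K\<^esub> \<one>\<^bsub>K\<^esub>) \<odot>\<^bsub>M\<^esub> t \<sigma> z)"
      unfolding T.avg_def using z W by (intro A.finsum_smult_ldistr) auto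
    also have "\<dots> = ga_act W M act (a_chi K W \<chi>) z"
      unfolding ga_act_def using z order_unit
      by (intro A.M.finsum_cong') (auto simp: a_chi_def t_def A.smult_assoc1)
    finally show ?thesis by simp
  qed
  have "g i \<sigma> = \<one>\<^bsub>K\<^esub> \<longleftrightarrow> \<gamma> i \<sigma> = \<chi> \<sigma>" if "i \<in> I" "\<sigma> \<in> carrier W" for i \<sigma>
  proof
    assume "g i \<sigma> = \<one>\<^bsub>K\<^esub>"
    then have "\<chi> \<sigma> \<otimes>\<^bsub>K\<^esub> g i \<sigma> = \<chi> \<sigma>" using that by simp
    then show "\<gamma> i \<sigma> = \<chi> \<sigma>"
      using that \<chi>_unit \<gamma>_unit by (simp add: g_def m_assoc[symmetric] Units_closed)
  qed (use that \<chi>_unit in \<open>simp add: g_def\<close>)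
  then have J: "index_chi W I \<phi> \<gamma> \<chi> = T.J"
    by (auto simp: index_chi_def T.J_def stabilizer_def)
  have fp: "module K (M\<lparr>carrier := T.fixed_points\<rparr>)"
    using submodule.submodule_is_module[OF T.fixed_points_submodule M] .
  show ?thesis
    unfolding diffs fixed_points J
  proof (intro conjI)
    show "basis_family K (M\<lparr>carrier := T.diffs\<rparr>)
           ((SIGMA i:Istar. Wrep i - stabilizer W \<phi> i) <+> (Istar \<inter> (I - T.J)))
           (case_sum
             (\<lambda>(i, \<sigma>). e i \<ominus>\<^bsub>M\<^esub> (inv\<^bsub>K\<^esub> (\<chi> \<sigma>) \<otimes>\<^bsub>K\<^esub> \<gamma> i \<sigma>) \<odot>\<^bsub>M\<^esub> e (\<phi> \<sigma> i))
             (\<lambda>i. e i))"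
      using T.basis_diffs unfolding T.S_def T.v_def unfolding g_def .
    show "basis_family K (M\<lparr>carrier := T.fixed_points\<rparr>) (Istar \<inter> T.J)
           (\<lambda>j. ga_act W M act (a_chi K W \<chi>) (e j))"
      \<comment> \<open>The two operators are known to agree only on the carrier of
        \<open>M\<close>, so the families are compared only at indices in the given index
        set.\<close>
      by (rule module.basis_family_cong[OF fp T.basis_fixed_points]) (simp add: avg T.Istar_I)
    show "basis_family K (factor_module M T.diffs) (Istar \<inter> T.J) (\<lambda>j. T.diffs +>\<^bsub>M\<^esub> e j)"
      by (rule T.basis_coinvariants)
  qed
qed

end
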